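(* Let $n\in\mathbb{N}$, $0<\alpha<n$, $1<p<\infty$, $0<\rho<\infty$, and let $\omega$ be a weight on $\mathbb{R}^n$ with $\omega'=\omega^{-\frac{1}{p-1}}\in A_\infty^{\rm loc}$. Then $$R_{\alpha,p;\rho}^{\omega}(E)\le C(n,\alpha,p,[\omega']_{A_{\infty;20\rho}^{\rm loc}})\,R_{\alpha,p;2\rho}^{\omega}(E),$$ where $E\subseteq\mathbb{R}^n$ is an arbitrary set. As a result, it holds that $$R_{\alpha,p;\rho_1}^{\omega}(\cdot)\approx R_{\alpha,p;\rho_2}^{\omega}(\cdot)$$ for all $0<\rho_1<\rho_2<\infty$, where the implicit constants depend only on $n$, $\alpha$, $p$, $[\omega]_{A_{p;c\rho_1}^{\rm loc}}$, and $c$ is a suitable constant multiplied to $\frac{\rho_2}{\rho_1}$.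
   Context: $C(a,b,\ldots)$ denotes a positive constant depending only on the indicated parameters. $A(\cdot)\approx B(\cdot)$ for set functions means $K^{-1}B(E)\le A(E)\le K\,B(E)$ for all $E\subseteq\mathbb{R}^n$ with a constant $K>0$ (the implicit constant) independent of $E$. $|x|_\infty=\max_i|x_i|$. Cubes are open with sides parallel to the axes; $\ell(Q)$ is the side length. A weight is a locally integrable function $\omega\ge0$ on $\mathbb{R}^n$ with $\omega>0$ a.e. For $1<p<\infty$ and $0<\rho<\infty$, $[\omega]_{A_{p;\rho}^{\rm loc}}=\sup_{\ell(Q)\le\rho}\left(\frac{1}{|Q|}\int_Q\omega\,dx\right)\left(\frac{1}{|Q|}\int_Q\omega^{-\frac{1}{p-1}}dx\right)^{p-1}$, and $[\omega]_{A_{\infty;\rho}^{\rm loc}}=\sup_{\ell(Q)\le\rho}\left(\frac{1}{|Q|}\int_Q\omega\,dx\right)\exp\left(\frac{1}{|Q|}\int_Q\log\omega(x)^{-1}dx\right)$; the class of weights with $[\omega]_{A_{\infty;\rho}^{\rm loc}}<\infty$ does not depend on $0<\rho<\infty$ and is denoted $A_\infty^{\rm loc}$. The local Riesz kernel is $I_{\alpha,\rho}(x)=|x|_\infty^{\alpha-n}\chi_{\{|x|_\infty<\rho\}}$. The weighted local Riesz capacity of $E\subseteq\mathbb{R}^n$ is $R_{\alpha,p;\rho}^{\omega}(E)=\inf\left\{\int_{\mathbb{R}^n}f^p\omega\,dx:\ f\ge0,\ f\in L^p(\omega),\ (I_{\alpha,\rho}\ast f)(x)\ge1\text{ for all }x\in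 E\right\}$ ($\inf\emptyset=\infty$).
   Formalization: The implicit constants in the equivalence may also depend on c, i.e. on ρ2/ρ1 (needed already for ω=1); their dependence on [ω]_{A_{p;cρ1}} is claimed only when this is finite, otherwise the constant may depend on ω, ρ1, ρ2. *)

theory Defs
  imports "HOL-Analysis.Analysis"
begin

definition cube :: "real^'n \<Rightarrow> real \<Rightarrow> (real^'n) set" where
  "cube a l = box a (a + (\<chi> i. l))"

definition weight :: "(real^'n \<Rightarrow> real) \<Rightarrow> bool" where
  "weight w \<longleftrightarrow>
     (\<forall>K. compact K \<longrightarrow> set_integrable lebesgue K w) \<and>
     (\<forall>x. 0 \<le> w x) \<and> (AE x in lebesgue. 0 < w x)"

text \<open>The power \<open>w\<^sup>-\<^sup>1\<^sup>/\<^sup>(\<^sup>p\<^sup>-\<^sup>1\<^sup>)\<close>. Where \<open>w\<close> vanishes (a null set, for a weight)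
  \<open>powr\<close> gives the value 0 instead of infinity.\<close>

definition dual_weight :: "real \<Rightarrow> (real^'n \<Rightarrow> real) \<Rightarrow> real^'n \<Rightarrow> real" where
  "dual_weight p w x = w x powr (- 1 / (p - 1))"

definition avg :: "(real^'n) set \<Rightarrow> (real^'n \<Rightarrow> real) \<Rightarrow> ennreal" where
  "avg Q f = (\<integral>\<^sup>+ x\<in>Q. ennreal (f x) \<partial>lebesgue) / emeasure lebesgue Q"

text \<open>Real powers on \<open>[0,\<infinity>]\<close>, used for positive exponents only.\<close>

definition ennreal_powr :: "ennreal \<Rightarrow> real \<Rightarrow> ennreal" where
  "ennreal_powr t r = (if t = \<infinity> then \<infinity> else ennreal (enn2real t powr r))"

definition Ap_const :: "real \<Rightarrow> real \<Rightarrow> (real^'n \<Rightarrow> real) \<Rightarrow> ennreal" where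
  "Ap_const p \<rho> w =
     (SUP (a, l) \<in> UNIV \<times> {0<..\<rho>}.
        avg (cube a l) w * ennreal_powr (avg (cube a l) (dual_weight p w)) (p - 1))"

text \<open>The quantity \<open>exp (1/|Q| \<integral>\<^sub>Q log (1/w))\<close> with values in \<open>[0,\<infinity>]\<close>. For a weight, the
  negative part of \<open>log (1/w)\<close> is bounded by \<open>w\<close> and so is integrable on a cube; hence
  non-integrability means that the integral is \<open>+\<infinity>\<close>.\<close>

definition exp_avg_log_inverse :: "(real^'n) set \<Rightarrow> (real^'n \<Rightarrow> real) \<Rightarrow> ennreal" where
  "exp_avg_log_inverse Q w =
     (if set_integrable lebesgue Q (\<lambda>x. ln (inverse (w x)))
      then ennreal (exp ((LINT x:Q|lebesgue. ln (inverse (w x))) / measure lebesgue Q))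
      else \<infinity>)"

definition Ainf_const :: "real \<Rightarrow> (real^'n \<Rightarrow> real) \<Rightarrow> ennreal" where
  "Ainf_const \<rho> w =
     (SUP (a, l) \<in> UNIV \<times> {0<..\<rho>}.
        avg (cube a l) w * exp_avg_log_inverse (cube a l) w)"

text \<open>The class does not depend on the scale, so finiteness is required at one scale only.\<close>

definition Ainf_loc :: "(real^'n \<Rightarrow> real) set" where
  "Ainf_loc = {w. weight w \<and> (\<exists>\<rho>>0. Ainf_const \<rho> w < \<infinity>)}"

text \<open>\<open>infnorm\<close> is the maximum norm. At the origin the kernel gets the value 0 instead of
  infinity, which does not affect the convolution below.\<close>

definition riesz_kernel :: "real \<Rightarrow> real \<Rightarrow> real^'n \<Rightarrow> real" where
  "riesz_kernel \<alpha> \<rho> x =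
     (if infnorm x < \<rho> then infnorm x powr (\<alpha> - real CARD('n)) else 0)"

definition riesz_potential :: "real \<Rightarrow> real \<Rightarrow> (real^'n \<Rightarrow> real) \<Rightarrow> real^'n \<Rightarrow> ennreal" where
  "riesz_potential \<alpha> \<rho> f x =
     (\<integral>\<^sup>+ y. ennreal (riesz_kernel \<alpha> \<rho> (x - y)) * ennreal (f y) \<partial>lebesgue)"

definition riesz_capacity ::
  "real \<Rightarrow> real \<Rightarrow> real \<Rightarrow> (real^'n \<Rightarrow> real) \<Rightarrow> (real^'n) set \<Rightarrow> ennreal" where
  "riesz_capacity \<alpha> p \<rho> w E =
     Inf {(\<integral>\<^sup>+ x. ennreal (f x powr p * w x) \<partial>lebesgue) | f.
            f \<in> borel_measurable lebesgue \<and> (\<forall>x. 0 \<le> f x) \<and>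
            (\<integral>\<^sup>+ x. ennreal (f x powr p * w x) \<partial>lebesgue) < \<infinity> \<and>
            (\<forall>x\<in>E. 1 \<le> riesz_potential \<alpha> \<rho> f x)}"

definition comparable ::
  "real \<Rightarrow> ((real^'n) set \<Rightarrow> ennreal) \<Rightarrow> ((real^'n) set \<Rightarrow> ennreal) \<Rightarrow> bool" where
  "comparable K A B \<longleftrightarrow>
     0 < K \<and> (\<forall>E. ennreal (inverse K) * B E \<le> A E \<and> A E \<le> ennreal K * B E)"

end

theory Submission
  imports Defs
begin

text \<open>Let \<open>v\<close> be the dual weight and let \<open>f\<close> be admissible for the larger radius \<open>s\<close>. Tile space by
  cubes \<open>Q\<close> of side \<open>r\<close>. On \<open>Q\<close> the part of the potential of \<open>f\<close> coming from distances between \<open>r\<close>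
  and \<open>s\<close> is at most \<open>r\<close> to the power \<open>\<alpha> - n\<close> times the integral of \<open>f\<close> over the
  \<open>s\<close>-neighbourhood of \<open>Q\<close>. Adding to \<open>f\<close> a suitable multiple of \<open>v\<close> on every \<open>Q\<close> compensates for
  this part with the kernel of radius \<open>r\<close>, and \<open>v\<^sup>p w = v\<close> together with a Hoelder-type estimate
  shows that the added energy is controlled by that of \<open>f\<close>, as soon as the \<open>v\<close>-mass of
  the neighbourhood of \<open>Q\<close> is bounded by that of \<open>Q\<close>. This doubling property is a consequence of the
  \<open>A\<^sub>\<infinity>\<close> condition at the scale of the neighbourhood.\<close>

subsection \<open>Doubling from the \<open>A\<^sub>\<infinity>\<close> condition\<close>

lemma mem_cube: "x \<in> cube a l \<longleftrightarrow> (\<forall>i. a $ i < x $ i \<and> x $ i < a $ i + l)"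
  by (auto simp: cube_def mem_box_cart)

lemma cube_sets [measurable, simp]: "cube a l \<in> sets lebesgue"
  by (simp add: cube_def)

lemma emeasure_cube:
  assumes "0 \<le> l"
  shows "emeasure lebesgue (cube a l :: (real^'n) set) = ennreal (l ^ CARD('n))"
proof -
  have "emeasure lborel (cube a l :: (real^'n) set) = ennreal (\<Prod>b\<in>Basis. (\<chi> i::'n. l) \<bullet> b)"
    unfolding cube_def
    by (subst emeasure_lborel_box) (use assms in \<open>auto simp: Basis_vec_def inner_axis algebra_simps\<close>)
  also have "(\<Prod>b\<in>(Basis::(real^'n) set). (\<chi> i::'n. l) \<bullet> b) = (\<Prod>b\<in>(Basis::(real^'n) set). l)"
    by (rule prod.cong) (auto simp: Basis_vec_def inner_axis)
  also have "\<dots> = l ^ CARD('n)"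
    by simp
  finally show ?thesis by (simp add: cube_def)
qed

lemma measure_cube: "0 \<le> l \<Longrightarrow> measure lebesgue (cube a l :: (real^'n) set) = l ^ CARD('n)"
  by (simp only: measure_def emeasure_cube) simp

lemma weight_set_integrable:
  assumes "weight w" "bounded S" "S \<in> sets lebesgue"
  shows "set_integrable lebesgue S w"
proof -
  obtain R where "S \<subseteq> cball 0 R"
    using assms(2) by (auto simp: bounded_iff subset_eq)
  moreover have "set_integrable lebesgue (cball 0 R) w"
    using assms(1) by (simp add: weight_def)
  ultimately show ?thesis
    by (intro set_integrable_subset[OF _ assms(3)])
qed

text \<open>Measurability is contained in integrability over balls: the truncations of
  \<open>w\<close> to balls are measurable and converge to \<open>w\<close> pointwise.\<close>

lemma weight_measurable:
  fixes w :: "real^'n \<Rightarrow> real"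
  assumes "weight w"
  shows "w \<in> borel_measurable lebesgue"
proof -
  define u where "u n x = indicator (cball 0 (real n)) x *\<^sub>R w x" for n and x :: "real^'n"
  have "u n \<in> borel_measurable lebesgue" for n
    using weight_set_integrable[OF assms, of "cball 0 (real n)"]
    by (auto simp: u_def[abs_def] set_integrable_def)
  moreover have "(\<lambda>n. u n x) \<longlonglongrightarrow> w x" for x
  proof (rule tendsto_eventually)
    show "\<forall>\<^sub>F n in sequentially. u n x = w x"
      using eventually_ge_at_top[of "nat \<lceil>norm x\<rceil>"]
      by eventually_elim (auto simp: u_def indicator_def nat_ceiling_le_eq)
  qed
  ultimately show ?thesis
    by (rule borel_measurable_LIMSEQ_real[rotated])
qed

section \<open>Integrals of positive functions and of their logarithms\<close>

lemma set_nn_integral_eq_set_LINT: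
  assumes "set_integrable M S v" "\<And>x. 0 \<le> v x"
  shows "(\<integral>\<^sup>+x\<in>S. ennreal (v x) \<partial>M) = ennreal (LINT x:S|M. v x)"
proof -
  have "(\<integral>\<^sup>+x\<in>S. ennreal (v x) \<partial>M) = (\<integral>\<^sup>+x. ennreal (indicator S x *\<^sub>R v x) \<partial>M)"
    by (auto intro!: nn_integral_cong simp: indicator_def)
  also have "\<dots> = ennreal (LINT x:S|M. v x)"
    using assms unfolding set_integrable_def set_lebesgue_integral_def
    by (intro nn_integral_eq_integral) auto
  finally show ?thesis .
qed

lemma set_LINT_pos:
  fixes v :: "'a \<Rightarrow> real"
  assumes "set_integrable M S v" "\<And>x. 0 \<le> v x" "AE x in M. 0 < v x"
    "S \<in> sets M" "emeasure M S \<noteq> 0"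
  shows "0 < (LINT x:S|M. v x)"
proof -
  have int: "integrable M (\<lambda>x. indicator S x *\<^sub>R v x)"
    using assms by (simp add: set_integrable_def)
  have "0 \<le> (LINT x:S|M. v x)"
    unfolding set_lebesgue_integral_def using assms(2) by (intro integral_nonneg_AE) auto
  moreover have "(LINT x:S|M. v x) \<noteq> 0"
  proof
    assume "(LINT x:S|M. v x) = 0"
    then have "AE x in M. indicator S x *\<^sub>R v x = 0"
      unfolding set_lebesgue_integral_def
      by (subst (asm) integral_nonneg_eq_0_iff_AE) (use int assms in auto)
    with assms(3) have "AE x in M. x \<notin> S"
      by eventually_elim (auto simp: indicator_def split: if_splits)
    then show False
      using assms(4,5) by (auto simp: null_sets_def simp flip: AE_iff_null_sets)
  qed
  ultimately show ?thesis by simp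
qed

text \<open>The case \<open>x = 0\<close> is included because \<open>inverse\<close> and
  \<open>ln\<close> both take the value 0 there.\<close>

lemma ln_inverse_nonneg: "0 \<le> x \<Longrightarrow> ln (inverse x) = - ln x" for x :: real
  by (cases "x = 0") (auto simp: ln_inverse)

text \<open>The logarithm is concave and lies below its tangent at \<open>a\<close>.\<close>

lemma ln_le_tangent: "0 < x \<Longrightarrow> 0 < a \<Longrightarrow> ln x \<le> x / a + ln a - 1" for x a :: real
  using ln_le_minus_one[of "x / a"] by (simp add: ln_div)

lemma set_integrable_const:
  "S \<in> sets M \<Longrightarrow> emeasure M S < \<infinity> \<Longrightarrow> set_integrable M S (\<lambda>_. c :: real)"
  by (simp add: set_integrable_def)

lemma set_LINT_const:
  "S \<in> sets M \<Longrightarrow> emeasure M S < \<infinity> \<Longrightarrow> (LINT x:S|M. c :: real) = measure M S * c"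
  by (simp add: set_lebesgue_integral_def)

text \<open>Jensen's inequality for the logarithm: the tangent at the average of \<open>v\<close>
  dominates \<open>ln v\<close>, and its integral is exactly the right-hand side.\<close>

lemma set_LINT_ln_le:
  fixes v :: "'a \<Rightarrow> real"
  assumes int: "set_integrable M S v" and lint: "set_integrable M S (\<lambda>x. ln (v x))"
    and nn: "\<And>x. 0 \<le> v x" and pos: "AE x in M. 0 < v x"
    and S: "S \<in> sets M" "emeasure M S \<noteq> 0" "emeasure M S < \<infinity>"
  shows "(LINT x:S|M. ln (v x)) \<le> measure M S * ln ((LINT x:S|M. v x) / measure M S)"
proof -
  define a where "a = (LINT x:S|M. v x) / measure M S"
  have mS: "0 < measure M S"
    using S by (simp add: measure_def enn2real_positive_iff zero_less_iff_neq_zero)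
  have a: "0 < a"
    unfolding a_def using set_LINT_pos[OF int nn pos S(1,2)] mS by simp
  have "(LINT x:S|M. ln (v x)) \<le> (LINT x:S|M. v x / a + (ln a - 1))"
  proof (rule set_integral_mono_AE)
    show "set_integrable M S (\<lambda>x. v x / a + (ln a - 1))"
      using int S by (intro set_integral_add set_integrable_const) auto
    show "AE x\<in>S in M. ln (v x) \<le> v x / a + (ln a - 1)"
      using pos by eventually_elim (use a in \<open>auto dest: ln_le_tangent\<close>)
  qed (use lint in auto)
  also have "\<dots> = (LINT x:S|M. v x) / a + measure M S * (ln a - 1)"
    using int S by (subst set_integral_add) (auto simp: set_integrable_const set_LINT_const algebra_simps)
  also have "(LINT x:S|M. v x) / a = measure M S"
    using a mS by (auto simp: a_def zero_less_divide_iff)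
  finally show ?thesis by (simp add: a_def algebra_simps)
qed

section \<open>The \<open>A\<^sub>\<infinity>\<close> condition, from one cube to all scales\<close>

lemma avg_eq:
  assumes "set_integrable lebesgue Q v" "\<And>x. 0 \<le> v x" "0 < measure lebesgue Q"
  shows "avg Q v = ennreal ((LINT x:Q|lebesgue. v x) / measure lebesgue Q)"
proof -
  have "emeasure lebesgue Q = ennreal (measure lebesgue Q)"
    using assms(3) by (intro emeasure_eq_ennreal_measure) (auto simp: measure_def)
  moreover have "0 \<le> (LINT x:Q|lebesgue. v x)"
    unfolding set_lebesgue_integral_def using assms(2) by (intro integral_nonneg_AE) auto
  ultimately show ?thesis
    unfolding avg_def using assms by (simp add: set_nn_integral_eq_set_LINT divide_ennreal)
qed

text \<open>Logarithmic form of the \<open>A\<^sub>\<infinity>\<close> bound. The average of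
  \<open>v\<close> is positive, so a finite product excludes the value infinity of
  \<open>exp_avg_log_inverse\<close>, that is, a non-integrable logarithm.\<close>

lemma Ainf_cubeD:
  assumes int: "set_integrable lebesgue Q v" and nn: "\<And>x. 0 \<le> v x"
    and pos: "AE x in lebesgue. 0 < v x"
    and Q: "Q \<in> sets lebesgue" "0 < measure lebesgue Q"
    and A: "avg Q v * exp_avg_log_inverse Q v \<le> ennreal A"
  shows "set_integrable lebesgue Q (\<lambda>x. ln (v x))"
    and "0 < A"
    and "measure lebesgue Q * ln ((LINT x:Q|lebesgue. v x) / measure lebesgue Q) \<le>
         (LINT x:Q|lebesgue. ln (v x)) + measure lebesgue Q * ln A"
proof -
  define V where "V = (LINT x:Q|lebesgue. v x) / measure lebesgue Q"
  define L where "L = (LINT x:Q|lebesgue. ln (inverse (v x)))"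
  have "emeasure lebesgue Q \<noteq> 0"
    using Q by (auto simp: measure_def)
  then have V: "0 < V"
    unfolding V_def using set_LINT_pos[OF int nn pos Q(1)] Q(2) by simp
  have avg: "avg Q v = ennreal V"
    unfolding V_def by (rule avg_eq[OF int nn Q(2)])
  have lnv: "ln (inverse (v x)) = - ln (v x)" for x
    using nn by (rule ln_inverse_nonneg)
  have *: "set_integrable lebesgue Q (\<lambda>x. ln (inverse (v x)))"
  proof (rule ccontr)
    assume "\<not> ?thesis"
    then show False
      using A V by (simp add: avg exp_avg_log_inverse_def ennreal_mult_top top_unique)
  qed
  then show "set_integrable lebesgue Q (\<lambda>x. ln (v x))"
    by (simp add: lnv set_integrable_def)
  have "ennreal (V * exp (L / measure lebesgue Q)) \<le> ennreal A"
    using A * V by (simp add: avg exp_avg_log_inverse_def ennreal_mult L_def)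
  moreover have "0 < V * exp (L / measure lebesgue Q)"
    using V by simp
  ultimately have "V * exp (L / measure lebesgue Q) \<le> A" and A0: "0 < A"
    by (auto simp: ennreal_le_iff2)
  then have "ln (V * exp (L / measure lebesgue Q)) \<le> ln A"
    using V by (subst ln_le_cancel_iff) auto
  then have "ln V + L / measure lebesgue Q \<le> ln A"
    using V by (simp add: ln_mult)
  then have "measure lebesgue Q * ln V + L \<le> measure lebesgue Q * ln A"
    using Q(2) by (simp add: field_simps)
  moreover have "L = - (LINT x:Q|lebesgue. ln (v x))"
    by (simp add: L_def lnv set_lebesgue_integral_def)
  ultimately show "measure lebesgue Q * ln ((LINT x:Q|lebesgue. v x) / measure lebesgue Q) \<le>
         (LINT x:Q|lebesgue. ln (v x)) + measure lebesgue Q * ln A"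
    by (simp add: V_def)
  show "0 < A" by (fact A0)
qed

text \<open>With \<open>V\<close> the average of \<open>v\<close> over \<open>Q\<close>, the function \<open>h = v / V - 1 - ln (v / V)\<close> is
  nonnegative and its integral over \<open>Q\<close> is at most \<open>|Q| ln A\<close>. Hence so is its integral over \<open>P\<close>,
  which by Jensen is at least \<open>|P| (ln (V / U) - 1)\<close>, where \<open>U\<close> is the average of \<open>v\<close> over \<open>P\<close>.\<close>

lemma Ainf_cube_doubling:
  assumes int: "set_integrable lebesgue Q v" and nn: "\<And>x. 0 \<le> v x"
    and pos: "AE x in lebesgue. 0 < v x"
    and Q: "Q \<in> sets lebesgue" "emeasure lebesgue Q < \<infinity>"
    and P: "P \<in> sets lebesgue" "0 < measure lebesgue P" "P \<subseteq> Q"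
    and A: "avg Q v * exp_avg_log_inverse Q v \<le> ennreal A"
    and N: "measure lebesgue Q = N * measure lebesgue P"
  shows "(LINT x:Q|lebesgue. v x) \<le> N * (exp 1 * A powr N) * (LINT x:P|lebesgue. v x)"
proof -
  let ?m = "measure lebesgue"
  define V where "V = (LINT x:Q|lebesgue. v x) / ?m Q"
  define U where "U = (LINT x:P|lebesgue. v x) / ?m P"
  have PQ: "?m P \<le> ?m Q"
    using P Q by (intro measure_mono_fmeasurable) (auto simp: fmeasurable_def)
  then have mQ: "0 < ?m Q" using P by simp
  have eP: "emeasure lebesgue P \<noteq> 0" "emeasure lebesgue P < \<infinity>"
    using P emeasure_mono[OF P(3) Q(1)] Q(2) by (auto simp: measure_def)
  have eQ: "emeasure lebesgue Q \<noteq> 0"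
    using mQ by (auto simp: measure_def)
  have V: "0 < V"
    unfolding V_def using set_LINT_pos[OF int nn pos Q(1) eQ] mQ by simp
  note AQ = Ainf_cubeD[OF int nn pos Q(1) mQ A]
  have intP: "set_integrable lebesgue P v"
    using int P by (meson set_integrable_subset)
  have lintP: "set_integrable lebesgue P (\<lambda>x. ln (v x))"
    using AQ(1) P by (meson set_integrable_subset)
  have U: "0 < U"
    unfolding U_def using set_LINT_pos[OF intP nn pos P(1) eP(1)] P by simp
  \<comment> \<open>The term \<open>ln (v / V)\<close> is expanded, so that the integral splits into
    those of \<open>v\<close>, of \<open>ln v\<close> and of a constant.\<close>
  define h where "h x = v x / V - ln (v x) + (ln V - 1)" for x
  have hS: "set_integrable lebesgue S h \<and> (LINT x:S|lebesgue. h x) =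
      (LINT x:S|lebesgue. v x) / V - (LINT x:S|lebesgue. ln (v x)) + ?m S * (ln V - 1)"
    if "S = P \<or> S = Q" for S
    using that int AQ(1) intP lintP P Q eP unfolding h_def[abs_def]
    by (auto simp: set_integrable_const set_LINT_const algebra_simps)
  have "(LINT x:P|lebesgue. h x) \<le> (LINT x:Q|lebesgue. h x)"
    unfolding set_lebesgue_integral_def
  proof (rule integral_mono_AE)
    show "AE x in lebesgue. indicator P x *\<^sub>R h x \<le> indicator Q x *\<^sub>R h x"
      using pos
    proof eventually_elim
      case (elim x)
      then have "0 \<le> h x"
        using ln_le_tangent[OF elim V] by (simp add: h_def)
      then show ?case
        using P by (auto simp: indicator_def)
    qed
  qed (use hS in \<open>auto simp: set_integrable_def\<close>)
  also have "\<dots> = ?m Q - (LINT x:Q|lebesgue. ln (v x)) + ?m Q * (ln V - 1)"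
    using hS[of Q] V mQ by (auto simp: V_def zero_less_divide_iff)
  also have "\<dots> \<le> ?m Q * ln A"
    using AQ(3) by (simp add: V_def algebra_simps)
  \<comment> \<open>Measuring \<open>Q\<close> in units of \<open>P\<close> produces the factor
    \<open>N\<close> before \<open>ln A\<close>, hence the exponent of \<open>A\<close> in the
    result.\<close>
  finally have "(LINT x:P|lebesgue. h x) \<le> ?m P * (N * ln A)"
    by (simp add: N mult_ac)
  \<comment> \<open>The integral of \<open>v / V\<close> over \<open>P\<close> is nonnegative and is
    dropped; Jensen bounds that of \<open>ln v\<close>.\<close>
  moreover have "(LINT x:P|lebesgue. h x) \<ge> - ?m P * ln U + ?m P * (ln V - 1)"
    using hS[of P] set_LINT_ln_le[OF intP lintP nn pos P(1) eP] U V P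
    by (simp add: U_def) (smt (verit) divide_nonneg_pos zero_less_divide_iff)
  ultimately have "?m P * (ln V - 1 - ln U) \<le> ?m P * (N * ln A)"
    by (simp add: algebra_simps)
  then have "ln V \<le> 1 + N * ln A + ln U"
    using P by simp
  then have "exp (ln V) \<le> exp (1 + N * ln A + ln U)"
    by (simp only: exp_le_cancel_iff)
  then have "V \<le> exp 1 * A powr N * U"
    using U V AQ(2) by (simp add: exp_add powr_def)
  then have "?m Q * V \<le> (exp 1 * A powr N) * (?m Q * U)"
    using mQ by (simp add: mult.left_commute)
  moreover have "?m Q * V = (LINT x:Q|lebesgue. v x)"
    using mQ by (simp add: V_def)
  moreover have "?m Q * U = N * (LINT x:P|lebesgue. v x)"
    using P by (simp add: U_def N)
  ultimately show ?thesis
    by (simp only:) (simp add: mult_ac)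
qed

lemma Ainf_constD:
  assumes "Ainf_const r v < \<infinity>" "0 < l" "l \<le> r"
  shows "avg (cube a l) v * exp_avg_log_inverse (cube a l) v \<le> ennreal (enn2real (Ainf_const r v))"
proof -
  have "avg (cube a l) v * exp_avg_log_inverse (cube a l) v \<le> Ainf_const r v"
    unfolding Ainf_const_def using assms(2,3) by (intro SUP_upper2[of "(a, l)"]) auto
  then show ?thesis using assms(1) by simp
qed

lemma weight_nonneg: "weight w \<Longrightarrow> 0 \<le> w x"
  by (simp add: weight_def)

lemma weight_pos_AE: "weight w \<Longrightarrow> AE x in lebesgue. 0 < w x"
  by (simp add: weight_def)

lemma weight_integrable_cube: "weight w \<Longrightarrow> set_integrable lebesgue (cube a l) w"
  by (rule weight_set_integrable) (simp_all add: cube_def bounded_box)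

text \<open>The power \<open>(l / s) ^ CARD('n)\<close> is the volume ratio of the two
  cubes.\<close>

lemma weight_cube_doubling:
  fixes v :: "real^'n \<Rightarrow> real"
  assumes v: "weight v"
    and A: "avg (cube a l) v * exp_avg_log_inverse (cube a l) v \<le> ennreal A"
    and s: "0 < s" "cube b s \<subseteq> cube a l" "0 \<le> l"
  shows "(LINT x:cube a l|lebesgue. v x)
    \<le> (l / s) ^ CARD('n) * (exp 1 * A powr ((l / s) ^ CARD('n))) * (LINT x:cube b s|lebesgue. v x)"
  using s
  by (intro Ainf_cube_doubling[OF weight_integrable_cube[OF v] weight_nonneg[OF v]
        weight_pos_AE[OF v] _ _ _ _ _ A])
     (auto simp: measure_cube emeasure_cube power_divide simp del: measure_completion emeasure_completion)

text \<open>A cube of side \<open>2 s\<close> is halved into \<open>Q k\<close>. Each \<open>Q k\<close> shares a subcube \<open>T k\<close> of side \<open>s / 2\<close>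
  with the central cube \<open>R\<close> of side \<open>s\<close>, so doubling at scale \<open>s\<close> makes all \<open>Q k\<close> comparable in mass.\<close>

lemma Ainf_const_double:
  fixes v :: "real^'n \<Rightarrow> real"
  assumes v: "weight v" and fin: "Ainf_const r v < \<infinity>"
  shows "Ainf_const (2 * r) v < \<infinity>"
proof -
  define A where "A = enn2real (Ainf_const r v)"
  \<comment> \<open>The doubling factor for a cube of side \<open>s\<close> and a subcube of side
    \<open>s / 2\<close>, whose volume ratio is \<open>2 ^ CARD('n)\<close>.\<close>
  define D where "D = 2 ^ CARD('n) * (exp 1 * A powr (2 ^ CARD('n)))"
  let ?\<mu> = "\<lambda>S. LINT x:S|lebesgue. v x"
  let ?m = "measure (lebesgue :: (real^'n) measure)"
  note int = weight_integrable_cube[OF v]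
  have "avg (cube a l) v * exp_avg_log_inverse (cube a l) v \<le> ennreal (D * D * A)"
    if l: "0 < l" "l \<le> 2 * r" for a :: "real^'n" and l
  proof -
    define s where "s = l / 2"
    have s: "0 < s" "s \<le> r" using l by (auto simp: s_def)
    define Q where "Q k = cube (a + (\<chi> i. if k i then s else 0)) s" for k :: "'n \<Rightarrow> bool"
    define R where "R = cube (a + (\<chi> i. s / 2)) s"
    \<comment> \<open>In each coordinate, relative to \<open>a\<close>, \<open>R\<close> spans
      \<open>s / 2\<close> to \<open>3 * s / 2\<close>, and \<open>T k\<close> is the half of the
      interval of \<open>Q k\<close> that faces the centre.\<close>
    define T where "T k = cube (a + (\<chi> i. if k i then s else s / 2)) (s / 2)" for k :: "'n \<Rightarrow> bool"
    have pos: "0 < ?\<mu> (cube b t)" if "0 < t" for b t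
      using that emeasure_cube[of t b]
      by (intro set_LINT_pos[OF int weight_nonneg[OF v] weight_pos_AE[OF v]])
         (auto simp del: emeasure_completion)
    have doubling: "?\<mu> (cube b s) \<le> D * ?\<mu> (cube c (s / 2))" if "cube c (s / 2) \<subseteq> cube b s" for b c
      using weight_cube_doubling[OF v Ainf_constD[OF fin s], of "s / 2" c b] s that
      by (simp add: D_def A_def)
    have mono: "?\<mu> (cube c (s / 2)) \<le> ?\<mu> (cube b s)" if "cube c (s / 2) \<subseteq> cube b s" for b c
      using int that weight_nonneg[OF v]
      unfolding set_lebesgue_integral_def set_integrable_def
      by (intro integral_mono) (auto simp: indicator_def)
    have D0: "0 \<le> D" by (simp add: D_def)
    have TQ: "T k \<subseteq> Q k" and TR: "T k \<subseteq> R" for k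
      unfolding T_def Q_def R_def using s
      by (auto simp: mem_cube subset_eq split: if_splits) (smt (verit) field_sum_of_halves)+
    have "?\<mu> (Q j) \<le> (D * D) * ?\<mu> (Q k)" for j k
    proof -
      have "?\<mu> (Q j) \<le> D * ?\<mu> (T j)"
        using doubling TQ[of j] by (simp add: Q_def T_def)
      also have "?\<mu> (T j) \<le> ?\<mu> R"
        using mono TR[of j] by (simp add: R_def T_def)
      also have "?\<mu> R \<le> D * ?\<mu> (T k)"
        using doubling TR[of k] by (simp add: R_def T_def)
      also have "?\<mu> (T k) \<le> ?\<mu> (Q k)"
        using mono TQ[of k] by (simp add: Q_def T_def)
      finally show ?thesis using D0 by (simp add: mult_left_mono)
    qed
    note comp = this
    define U where "U = (\<Union>k. Q k)"
    have disj: "disjoint_family Q"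
    proof (clarsimp simp: disjoint_family_on_def)
      fix k k' :: "'n \<Rightarrow> bool" assume "k \<noteq> k'"
      then obtain i where "k i \<noteq> k' i" by blast
      then show "Q k \<inter> Q k' = {}"
        by (auto simp: Q_def mem_cube dest!: spec[of _ i] split: if_splits)
    qed
    \<comment> \<open>The open pieces miss only the hyperplanes that halve the cube, and these are
      null sets.\<close>
    have AE_U: "AE x in lebesgue. x \<in> U \<longleftrightarrow> x \<in> cube a l"
    proof -
      have "AE x in lebesgue. x $ i \<noteq> a $ i + s" for i
        using AE_not_in[of "{x. x $ i = a $ i + s}" lebesgue]
          negligible_standard_hyperplane[of "axis i 1 :: real^'n" "a $ i + s"]
        by (auto simp: negligible_iff_null_sets inner_axis axis_in_Basis_iff)
      then have "AE x in lebesgue. \<forall>i. x $ i \<noteq> a $ i + s"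
        by (simp add: AE_all_countable)
      then show ?thesis
      proof eventually_elim
        case (elim x)
        show ?case
        proof
          assume "x \<in> U"
          then obtain k where "x \<in> Q k" by (auto simp: U_def)
          then show "x \<in> cube a l"
            using s by (auto simp: Q_def mem_cube s_def split: if_splits) (smt (verit) field_sum_of_halves)+
        next
          assume "x \<in> cube a l"
          then have "x \<in> Q (\<lambda>i. a $ i + s < x $ i)"
            using elim by (auto simp: Q_def mem_cube s_def) (smt (verit) field_sum_of_halves)+
          then show "x \<in> U" by (auto simp: U_def)
        qed
      qed
    qed
    have Qsets: "Q k \<in> sets lebesgue" for k by (simp add: Q_def)
    have mQ: "?m (Q k) = s ^ CARD('n)" for k
      using s by (simp add: Q_def measure_cube del: measure_completion)
    \<comment> \<open>Used twice below: for \<open>v\<close> to compare masses and for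
      \<open>ln v\<close> to add up the logarithmic bounds.\<close>
    have split: "set_integrable lebesgue (cube a l) f \<and>
        (LINT x:cube a l|lebesgue. f x) = (\<Sum>k\<in>UNIV. LINT x:Q k|lebesgue. f x)"
      if f: "f \<in> borel_measurable lebesgue" "\<And>k. set_integrable lebesgue (Q k) f" for f :: "real^'n \<Rightarrow> real"
    proof
      have "set_integrable lebesgue U f"
        unfolding U_def using f Qsets by (intro set_integrable_UN) auto
      moreover have "set_integrable lebesgue U f = set_integrable lebesgue (cube a l) f"
        unfolding set_integrable_def
        using f(1) AE_U Qsets by (intro integrable_cong_AE) (auto simp: U_def indicator_def)
      ultimately show "set_integrable lebesgue (cube a l) f" by simp
      have "(LINT x:cube a l|lebesgue. f x) = (LINT x:U|lebesgue. f x)"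
        using f(1) Qsets AE_U
        by (intro set_integral_cong_set) (auto simp: set_borel_measurable_def U_def)
      also have "\<dots> = (\<Sum>k\<in>UNIV. LINT x:Q k|lebesgue. f x)"
        unfolding U_def using f(2) Qsets disj by (intro set_integral_finite_Union) auto
      finally show "(LINT x:cube a l|lebesgue. f x) = (\<Sum>k\<in>UNIV. LINT x:Q k|lebesgue. f x)" .
    qed
    have vm [measurable]: "v \<in> borel_measurable lebesgue" by (rule weight_measurable[OF v])
    define V where "V = ?\<mu> (cube a l) / ?m (cube a l)"
    have m: "?m (cube a l) = 2 ^ CARD('n) * s ^ CARD('n)"
      using l by (simp add: measure_cube s_def power_divide del: measure_completion)
    have V: "0 < V"
      unfolding V_def m using pos[OF l(1)] s by simp
    \<comment> \<open>Each of the \<open>2 ^ CARD('n)\<close> pieces has at most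
      \<open>D * D\<close> times the mass of \<open>Q k\<close>. Their number is also the volume
      ratio, so it cancels when passing to averages.\<close>
    have "?\<mu> (cube a l) \<le> 2 ^ CARD('n) * (D * D * ?\<mu> (Q k))" for k
    proof -
      have "?\<mu> (cube a l) = (\<Sum>j\<in>UNIV. ?\<mu> (Q j))"
        using split[OF vm] int by (simp add: Q_def)
      also have "\<dots> \<le> (\<Sum>j\<in>(UNIV::('n \<Rightarrow> bool) set). D * D * ?\<mu> (Q k))"
        by (intro sum_mono comp)
      finally show ?thesis by (simp add: card_fun)
    qed
    then have VQ: "V \<le> D * D * (?\<mu> (Q k) / ?m (Q k))" for k
      unfolding V_def m mQ using s by (simp add: field_simps)
    have A: "avg (Q k) v * exp_avg_log_inverse (Q k) v \<le> ennreal A" for k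
      unfolding Q_def A_def by (rule Ainf_constD[OF fin s])
    note AQ = Ainf_cubeD[OF int weight_nonneg[OF v] weight_pos_AE[OF v] _ _ A[unfolded Q_def], folded Q_def]
    have mQ0: "0 < ?m (Q k)" for k using s by (simp add: mQ del: measure_completion)
    have A0: "0 < A" using AQ(2)[OF Qsets mQ0] .
    then have D0: "0 < D" by (simp add: D_def)
    have lnQ: "set_integrable lebesgue (Q k) (\<lambda>x. ln (v x))" for k
      using AQ(1)[OF Qsets mQ0] .
    \<comment> \<open>The \<open>A\<^sub>\<infinity>\<close> bound on \<open>Q k\<close> controls
      the logarithm by the average over \<open>Q k\<close>, which is then replaced by
      \<open>V\<close> at the cost of \<open>D * D\<close>.\<close>
    have "s ^ CARD('n) * (ln V - ln (D * D * A)) \<le> (LINT x:Q k|lebesgue. ln (v x))" for k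
    proof -
      define q where "q = ?\<mu> (Q k) / ?m (Q k)"
      have q: "0 < q"
        unfolding q_def using pos[OF s(1)] mQ0[of k] by (simp add: Q_def)
      have "ln V \<le> ln (D * D * q)"
        using V VQ[of k] by (simp add: q_def)
      then have "ln V - ln (D * D * A) \<le> ln q - ln A"
        using A0 D0 q by (simp add: ln_mult)
      then have "?m (Q k) * (ln V - ln (D * D * A)) \<le> ?m (Q k) * (ln (?\<mu> (Q k) / ?m (Q k)) - ln A)"
        using mQ0[of k] by (simp add: q_def)
      also have "\<dots> \<le> (LINT x:Q k|lebesgue. ln (v x))"
        using AQ(3)[OF Qsets mQ0, of k] by (simp add: right_diff_distrib)
      finally show ?thesis by (simp add: mQ)
    qed
    then have "(\<Sum>k\<in>(UNIV::('n \<Rightarrow> bool) set). s ^ CARD('n) * (ln V - ln (D * D * A)))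
        \<le> (\<Sum>k\<in>UNIV. LINT x:Q k|lebesgue. ln (v x))"
      by (intro sum_mono)
    \<comment> \<open>Summed over the pieces, this is the logarithmic form of the
      \<open>A\<^sub>\<infinity>\<close> bound on the large cube, with constant
      \<open>D * D * A\<close>.\<close>
    then have L: "?m (cube a l) * (ln V - ln (D * D * A)) \<le> (LINT x:cube a l|lebesgue. ln (v x))"
      using split[OF _ lnQ] by (simp add: m card_fun mult.assoc)
    have lnv: "ln (inverse (v x)) = - ln (v x)" for x
      using weight_nonneg[OF v] by (rule ln_inverse_nonneg)
    have "set_integrable lebesgue (cube a l) (\<lambda>x. ln (inverse (v x)))"
      using split[OF _ lnQ] by (simp add: lnv set_integrable_def)
    moreover have "avg (cube a l) v = ennreal V"
      unfolding V_def using s by (intro avg_eq int weight_nonneg[OF v]) (simp add: m)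
    moreover have "V * exp ((LINT x:cube a l|lebesgue. ln (inverse (v x))) / ?m (cube a l)) \<le> D * D * A"
    proof -
      have "(LINT x:cube a l|lebesgue. ln (inverse (v x))) / ?m (cube a l) \<le> ln (D * D * A) - ln V"
      proof -
        have "(LINT x:cube a l|lebesgue. ln (inverse (v x))) = - (LINT x:cube a l|lebesgue. ln (v x))"
          unfolding lnv by (simp add: set_lebesgue_integral_def)
        moreover have "0 < ?m (cube a l)" using s by (simp add: m)
        ultimately show ?thesis using L by (simp add: field_simps)
      qed
      then have "V * exp ((LINT x:cube a l|lebesgue. ln (inverse (v x))) / ?m (cube a l))
          \<le> V * exp (ln (D * D * A) - ln V)"
        using V by simp
      also have "\<dots> = D * D * A"
        using V A0 D0 by (simp add: exp_diff)
      finally show ?thesis .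
    qed
    ultimately show ?thesis
      using V by (auto simp: exp_avg_log_inverse_def intro!: ennreal_leI simp flip: ennreal_mult)
  qed
  then have "Ainf_const (2 * r) v \<le> ennreal (D * D * A)"
    unfolding Ainf_const_def by (intro SUP_least) auto
  then show ?thesis
    using order_le_less_trans[OF _ ennreal_less_top] by simp
qed

lemma Ainf_const_mono: "r \<le> r' \<Longrightarrow> Ainf_const r v \<le> Ainf_const r' v"
  unfolding Ainf_const_def by (intro SUP_subset_mono) auto

text \<open>The class does not depend on the scale: finiteness at one scale passes to its double,
  hence by iteration to every larger one, and to smaller ones by monotonicity.\<close>

lemma Ainf_loc_const_finite:
  assumes "v \<in> Ainf_loc"
  shows "Ainf_const r v < \<infinity>"
proof -
  obtain r0 where v: "weight v" and r0: "0 < r0" "Ainf_const r0 v < \<infinity>"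
    using assms by (auto simp: Ainf_loc_def)
  have "Ainf_const (2 ^ k * r0) v < \<infinity>" for k
    by (induction k) (use r0 Ainf_const_double[OF v] in \<open>auto simp: mult.assoc\<close>)
  moreover obtain k where "r / r0 < 2 ^ k"
    using real_arch_pow[of 2 "r / r0"] by auto
  then have "r \<le> 2 ^ k * r0"
    using r0 by (simp add: field_simps)
  ultimately show ?thesis
    using Ainf_const_mono order_le_less_trans by blast
qed

text \<open>For the dual weight, \<open>ln (1 / v)\<close> is \<open>ln w / (p - 1)\<close>, so by
  Jensen the exponential factor is at most the average of \<open>w\<close> to the power
  \<open>1 / (p - 1)\<close>. The whole product is then bounded by the \<open>A\<^sub>p\<close>
  product raised to that power.\<close>

lemma Ap_const_dual_Ainf:
  assumes w: "weight w" and w': "weight (dual_weight p w)" and p: "1 < p"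
    and fin: "Ap_const p r w < \<infinity>" and l: "0 < l" "l \<le> r"
  shows "avg (cube a l) (dual_weight p w) * exp_avg_log_inverse (cube a l) (dual_weight p w)
    \<le> ennreal (enn2real (Ap_const p r w) powr (1 / (p - 1)))"
proof -
  define B where "B = enn2real (Ap_const p r w)"
  define Q where "Q = cube a l"
  define m where "m = measure lebesgue Q"
  define x where "x = (LINT y:Q|lebesgue. w y) / m"
  define y where "y = (LINT y:Q|lebesgue. dual_weight p w y) / m"
  have m: "0 < m"
    using l unfolding m_def Q_def by (simp add: measure_cube del: measure_completion)
  have Q: "Q \<in> sets lebesgue" "emeasure lebesgue Q \<noteq> 0" "emeasure lebesgue Q < \<infinity>"
    using l emeasure_cube[of l a] by (auto simp: Q_def simp del: emeasure_completion)
  have int: "set_integrable lebesgue Q w" "set_integrable lebesgue Q (dual_weight p w)"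
    unfolding Q_def by (rule weight_integrable_cube; fact)+
  have x: "0 < x"
    unfolding x_def using set_LINT_pos[OF int(1) weight_nonneg[OF w] weight_pos_AE[OF w] Q(1,2)] m by simp
  have y: "0 < y"
    unfolding y_def using set_LINT_pos[OF int(2) weight_nonneg[OF w'] weight_pos_AE[OF w'] Q(1,2)] m by simp
  have avg: "avg Q w = ennreal x" "avg Q (dual_weight p w) = ennreal y"
    unfolding x_def y_def m_def using m
    by (intro avg_eq int weight_nonneg w w'; simp add: m_def)+
  have "avg Q w * ennreal_powr (avg Q (dual_weight p w)) (p - 1) \<le> Ap_const p r w"
    unfolding Ap_const_def Q_def using l by (intro SUP_upper2[of "(a, l)"]) auto
  also have "\<dots> = ennreal B"
    using fin by (simp add: B_def)
  finally have "ennreal (x * y powr (p - 1)) \<le> ennreal B"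
    using x y by (simp add: avg ennreal_powr_def ennreal_mult)
  then have B: "x * y powr (p - 1) \<le> B"
    by (simp add: B_def)
  have ln_dual: "ln (dual_weight p w z) = - (1 / (p - 1)) * ln (w z)" for z
    by (cases "w z = 0") (auto simp: dual_weight_def ln_powr)
  have lnv: "ln (inverse (dual_weight p w z)) = (1 / (p - 1)) * ln (w z)" for z
    using ln_inverse_nonneg[OF weight_nonneg[OF w', of z]] ln_dual[of z] by simp
  \<comment> \<open>The inequality \<open>ln t \<le> t\<close>, applied to \<open>w\<close> and to
    the dual weight, bounds \<open>ln w\<close> from above and from below by integrable
    functions.\<close>
  have lint: "set_integrable lebesgue Q (\<lambda>z. ln (w z))"
  proof (rule set_integrable_bound)
    show "set_integrable lebesgue Q (\<lambda>z. w z + (p - 1) * dual_weight p w z)"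
      using int by (intro set_integral_add) auto
    show "set_borel_measurable lebesgue Q (\<lambda>z. ln (w z))"
      using weight_measurable[OF w] Q(1) by (simp add: set_borel_measurable_def)
    show "AE z in lebesgue. z \<in> Q \<longrightarrow> norm (ln (w z)) \<le> norm (w z + (p - 1) * dual_weight p w z)"
      using weight_pos_AE[OF w] weight_pos_AE[OF w']
    proof eventually_elim
      case (elim z)
      have "ln (w z) \<le> w z" "ln (dual_weight p w z) \<le> dual_weight p w z"
        using elim ln_bound by auto
      moreover from this(2) have "- ln (w z) \<le> (p - 1) * dual_weight p w z"
        using p unfolding ln_dual by (simp add: field_simps)
      moreover have "0 \<le> (p - 1) * dual_weight p w z"
        using elim p by simp
      ultimately show ?case using elim by auto
    qed
  qed
  have "(LINT z:Q|lebesgue. ln (w z)) \<le> m * ln x"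
    using set_LINT_ln_le[OF int(1) lint weight_nonneg[OF w] weight_pos_AE[OF w] Q] by (simp add: m_def x_def)
  then have "exp ((LINT z:Q|lebesgue. ln (inverse (dual_weight p w z))) / m) \<le> exp ((1 / (p - 1)) * ln x)"
  proof -
    have "(LINT z:Q|lebesgue. ln (inverse (dual_weight p w z))) = (1 / (p - 1)) * (LINT z:Q|lebesgue. ln (w z))"
      unfolding lnv by (rule set_integral_mult_right)
    then show ?thesis
      using \<open>(LINT z:Q|lebesgue. ln (w z)) \<le> m * ln x\<close> p m by (simp add: field_simps)
  qed
  also have "\<dots> = x powr (1 / (p - 1))"
    using x by (simp add: powr_def)
  finally have "y * exp ((LINT z:Q|lebesgue. ln (inverse (dual_weight p w z))) / m) \<le> y * x powr (1 / (p - 1))"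
    using y by simp
  also have "\<dots> = (x * y powr (p - 1)) powr (1 / (p - 1))"
    using x y p by (simp add: powr_mult powr_powr)
  also have "\<dots> \<le> B powr (1 / (p - 1))"
    using B x y p by (intro powr_mono2) auto
  finally have "ennreal (y * exp ((LINT z:Q|lebesgue. ln (inverse (dual_weight p w z))) / m))
      \<le> ennreal (B powr (1 / (p - 1)))"
    by (rule ennreal_leI)
  moreover have "set_integrable lebesgue Q (\<lambda>z. ln (inverse (dual_weight p w z)))"
    unfolding lnv using lint by simp
  ultimately have "avg Q (dual_weight p w) * exp_avg_log_inverse Q (dual_weight p w) \<le> ennreal (B powr (1 / (p - 1)))"
    using y by (simp add: avg exp_avg_log_inverse_def m_def ennreal_mult)
  then show ?thesis by (simp add: Q_def B_def)
qed

subsection \<open>The grid\<close>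

text \<open>The floor makes the tiles half-open, so they partition the space with no exceptional
  set.\<close>

definition grid_index :: "real \<Rightarrow> real^'n \<Rightarrow> 'n \<Rightarrow> int" where
  "grid_index r x = (\<lambda>i. \<lfloor>x $ i / r\<rfloor>)"

definition grid_cube :: "real \<Rightarrow> ('n \<Rightarrow> int) \<Rightarrow> (real^'n) set" where
  "grid_cube r k = {x. grid_index r x = k}"

text \<open>The neighbourhood in the maximum norm is itself a cube, so the
  \<open>A\<^sub>\<infinity>\<close> condition applies to it directly.\<close>

definition grid_nbhd :: "real \<Rightarrow> real \<Rightarrow> ('n \<Rightarrow> int) \<Rightarrow> (real^'n) set" where
  "grid_nbhd r s k = cube (\<chi> i. r * of_int (k i) - s) (r + 2 * s)"

lemma mem_grid_cube:
  assumes "0 < r"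
  shows "x \<in> grid_cube r k \<longleftrightarrow> (\<forall>i. r * of_int (k i) \<le> x $ i \<and> x $ i < r * of_int (k i) + r)"
proof -
  have "\<lfloor>x $ i / r\<rfloor> = k i \<longleftrightarrow> r * of_int (k i) \<le> x $ i \<and> x $ i < r * of_int (k i) + r" for i
    using assms by (auto simp: floor_eq_iff field_simps)
  then show ?thesis by (simp add: grid_cube_def grid_index_def fun_eq_iff)
qed

lemma grid_cube_sets:
  fixes k :: "'n::finite \<Rightarrow> int"
  assumes "0 < r"
  shows "grid_cube r k \<in> sets lebesgue"
proof -
  from assms have "grid_cube r k = (\<Inter>i. {x. r * of_int (k i) \<le> x $ i} \<inter> {x. x $ i < r * of_int (k i) + r})"
    by (auto simp: mem_grid_cube)
  moreover have "{x::real^'n. r * of_int (k i) \<le> x $ i} \<inter> {x. x $ i < r * of_int (k i) + r} \<in> sets lebesgue" for i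
  proof (rule sets.Int)
    have "closed {x::real^'n. r * of_int (k i) \<le> x $ i}"
      by (intro closed_Collect_le continuous_intros)
    then show "{x::real^'n. r * of_int (k i) \<le> x $ i} \<in> sets lebesgue" by simp
    have "open {x::real^'n. x $ i < r * of_int (k i) + r}"
      by (intro open_Collect_less continuous_intros)
    then show "{x::real^'n. x $ i < r * of_int (k i) + r} \<in> sets lebesgue" by simp
  qed
  ultimately show ?thesis
    by (simp add: sets.finite_INT)
qed

lemma weight_integrable_grid_cube:
  fixes v :: "real^'n \<Rightarrow> real"
  assumes "weight v" and r: "0 < r"
  shows "set_integrable lebesgue (grid_cube r k) v"
proof (rule weight_set_integrable[OF assms(1) _ grid_cube_sets[OF r]])
  have "grid_cube r k \<subseteq> cbox (\<chi> i. r * of_int (k i)) (\<chi> i. r * of_int (k i) + r)"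
    by (auto simp: mem_grid_cube[OF r] mem_box_cart less_imp_le)
  then show "bounded (grid_cube r k)"
    using bounded_cbox bounded_subset by blast
qed

lemma grid_index_measurable:
  assumes "0 < r"
  shows "grid_index r \<in> measurable lebesgue (count_space (UNIV :: ('n::finite \<Rightarrow> int) set))"
proof -
  have "grid_index r -` {k} \<in> sets lebesgue" for k :: "'n \<Rightarrow> int"
    using grid_cube_sets[OF assms, of k] by (simp add: grid_cube_def vimage_def)
  then show ?thesis by (simp add: measurable_count_space_eq_countable)
qed

lemma cube_subset_grid_cube: "0 < r \<Longrightarrow> cube (\<chi> i. r * of_int (k i)) r \<subseteq> grid_cube r k"
  by (auto simp: mem_cube mem_grid_cube less_imp_le)

lemma cube_subset_grid_nbhd:
  "0 < r \<Longrightarrow> 0 < s \<Longrightarrow> cube (\<chi> i. r * of_int (k i)) r \<subseteq> grid_nbhd r s k"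
  by (auto simp: mem_cube grid_nbhd_def) (smt (verit))+

lemma infnorm_less_cart: "infnorm (x :: real^'n) < r \<longleftrightarrow> (\<forall>i. \<bar>x $ i\<bar> < r)"
  by (auto simp: infnorm_Max Basis_vec_def inner_axis)

lemma grid_nbhdI:
  "0 < r \<Longrightarrow> x \<in> grid_cube r k \<Longrightarrow> infnorm (x - y) < s \<Longrightarrow> y \<in> grid_nbhd r s k"
  by (auto simp: mem_grid_cube infnorm_less_cart grid_nbhd_def mem_cube abs_less_iff) (smt (verit))+

lemma grid_cube_diameter:
  "0 < r \<Longrightarrow> x \<in> grid_cube r k \<Longrightarrow> y \<in> grid_cube r k \<Longrightarrow> infnorm (x - y) < r"
  by (auto simp: mem_grid_cube infnorm_less_cart abs_less_iff) (smt (verit))+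

text \<open>Each coordinate of an index \<open>k\<close> whose neighbourhood contains
  \<open>y\<close> lies between two floors that depend on \<open>y\<close> only.\<close>

lemma grid_nbhd_overlap:
  fixes y :: "real^'n"
  assumes r: "0 < r" and s: "0 < s"
  shows "finite {k. y \<in> grid_nbhd r s k}"
    and "real (card {k. y \<in> grid_nbhd r s k}) \<le> (2 * s / r + 2) ^ CARD('n)"
proof -
  define J where "J i = {\<lfloor>(y $ i - s) / r\<rfloor> .. \<lfloor>(y $ i + s) / r\<rfloor>}" for i
  have sub: "{k. y \<in> grid_nbhd r s k} \<subseteq> PiE UNIV J"
  proof (clarsimp simp: PiE_UNIV_domain J_def)
    fix k :: "'n \<Rightarrow> int" and i
    assume "y \<in> grid_nbhd r s k"
    then have "r * of_int (k i) < y $ i + s" "y $ i - s < r * of_int (k i) + r"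
      by (auto simp: grid_nbhd_def mem_cube algebra_simps dest: spec[of _ i])
    then have "of_int (k i) \<le> (y $ i + s) / r" "(y $ i - s) / r < of_int (k i) + 1"
      using r by (simp_all add: field_simps)
    then show "\<lfloor>(y $ i - s) / r\<rfloor> \<le> k i \<and> k i \<le> \<lfloor>(y $ i + s) / r\<rfloor>"
      by linarith
  qed
  have finJ: "finite (PiE UNIV J)"
    by (intro finite_PiE) (auto simp: J_def)
  then show "finite {k. y \<in> grid_nbhd r s k}"
    using sub by (rule rev_finite_subset)
  \<comment> \<open>Between the floors of \<open>t\<close> and of \<open>t + d\<close> there are at
    most \<open>d + 2\<close> integers, both ends included.\<close>
  have cardJ: "real (card (J i)) \<le> 2 * s / r + 2" for i
  proof -
    have "(y $ i + s) / r = (y $ i - s) / r + 2 * s / r"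
      by (simp add: add_divide_distrib[symmetric])
    moreover have "0 \<le> 2 * s / r" using r s by simp
    ultimately show ?thesis
      unfolding J_def card_atLeastAtMost_int by linarith
  qed
  have "real (card {k. y \<in> grid_nbhd r s k}) \<le> real (card (PiE UNIV J))"
    using card_mono[OF finJ sub] by simp
  also have "\<dots> = (\<Prod>i\<in>UNIV. real (card (J i)))"
    by (simp add: card_PiE)
  also have "\<dots> \<le> (\<Prod>i\<in>(UNIV::'n set). 2 * s / r + 2)"
    using cardJ by (intro prod_mono) auto
  finally show "real (card {k. y \<in> grid_nbhd r s k}) \<le> (2 * s / r + 2) ^ CARD('n)"
    by simp
qed

text \<open>Allows an integrand that changes from tile to tile. At each point exactly one indicator
  is nonzero, and Tonelli exchanges the sum with the integral.\<close>

lemma nn_integral_grid: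
  fixes h :: "('n::finite \<Rightarrow> int) \<Rightarrow> real^'n \<Rightarrow> ennreal"
  assumes "0 < r" and [measurable]: "\<And>k. h k \<in> borel_measurable lebesgue"
  shows "(\<integral>\<^sup>+x. h (grid_index r x) x \<partial>lebesgue)
    = (\<integral>\<^sup>+k. (\<integral>\<^sup>+x\<in>grid_cube r k. h k x \<partial>lebesgue) \<partial>count_space UNIV)"
proof -
  note [measurable] = grid_cube_sets[OF assms(1)]
  have "h (grid_index r x) x = (\<integral>\<^sup>+k. h k x * indicator (grid_cube r k) x \<partial>count_space UNIV)" for x
    by (subst nn_integral_count_space'[of "{grid_index r x}"]) (auto simp: grid_cube_def)
  then have "(\<integral>\<^sup>+x. h (grid_index r x) x \<partial>lebesgue)
      = (\<integral>\<^sup>+x. (\<integral>\<^sup>+k. h k x * indicator (grid_cube r k) x \<partial>count_space UNIV) \<partial>lebesgue)"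
    by simp
  also have "\<dots> = (\<integral>\<^sup>+k. (\<integral>\<^sup>+x\<in>grid_cube r k. h k x \<partial>lebesgue) \<partial>count_space UNIV)"
    by (rule nn_integral_count_space_nn_integral) auto
  finally show ?thesis .
qed

text \<open>Tonelli reduces the claim to the number of neighbourhoods that contain a given
  point.\<close>

lemma nn_integral_grid_nbhd_le:
  fixes u :: "real^'n \<Rightarrow> ennreal"
  assumes "0 < r" "0 < s" and [measurable]: "u \<in> borel_measurable lebesgue"
  shows "(\<integral>\<^sup>+k. (\<integral>\<^sup>+x\<in>grid_nbhd r s k. u x \<partial>lebesgue) \<partial>count_space UNIV)
    \<le> ennreal ((2 * s / r + 2) ^ CARD('n)) * (\<integral>\<^sup>+x. u x \<partial>lebesgue)"
proof -
  have [measurable]: "grid_nbhd r s k \<in> sets lebesgue" for k :: "'n \<Rightarrow> int"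
    by (simp add: grid_nbhd_def)
  have overlap: "(\<integral>\<^sup>+k. indicator (grid_nbhd r s k) x \<partial>count_space UNIV) \<le> ennreal ((2 * s / r + 2) ^ CARD('n))"
    for x :: "real^'n"
  proof -
    have "(\<integral>\<^sup>+k. indicator (grid_nbhd r s k) x \<partial>count_space UNIV)
        = (\<integral>\<^sup>+k. indicator {k. x \<in> grid_nbhd r s k} k \<partial>count_space UNIV)"
      by (intro nn_integral_cong) (auto simp: indicator_def)
    also have "\<dots> = of_nat (card {k. x \<in> grid_nbhd r s k})"
      using grid_nbhd_overlap(1)[OF assms(1,2), of x] by simp
    also have "\<dots> \<le> ennreal ((2 * s / r + 2) ^ CARD('n))"
      using grid_nbhd_overlap(2)[OF assms(1,2), of x]
      by (metis ennreal_leI ennreal_of_nat_eq_real_of_nat)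
    finally show ?thesis .
  qed
  have "(\<integral>\<^sup>+k. (\<integral>\<^sup>+x\<in>grid_nbhd r s k. u x \<partial>lebesgue) \<partial>count_space UNIV)
      = (\<integral>\<^sup>+x. (\<integral>\<^sup>+k. u x * indicator (grid_nbhd r s k) x \<partial>count_space UNIV) \<partial>lebesgue)"
    by (rule nn_integral_count_space_nn_integral[symmetric]) auto
  also have "\<dots> = (\<integral>\<^sup>+x. u x * (\<integral>\<^sup>+k. indicator (grid_nbhd r s k) x \<partial>count_space UNIV) \<partial>lebesgue)"
    by (simp add: nn_integral_cmult)
  also have "\<dots> \<le> (\<integral>\<^sup>+x. ennreal ((2 * s / r + 2) ^ CARD('n)) * u x \<partial>lebesgue)"
    using overlap by (intro nn_integral_mono) (metis mult.commute mult_left_mono zero_le)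
  also have "\<dots> = ennreal ((2 * s / r + 2) ^ CARD('n)) * (\<integral>\<^sup>+x. u x \<partial>lebesgue)"
    by (simp add: nn_integral_cmult)
  finally show ?thesis .
qed

text \<open>Where the first summand is smaller than \<open>f\<close>, the factor multiplying \<open>f\<close> in the second
  one exceeds 1. This replaces Hoelder's inequality.\<close>

lemma le_dual_weight_add:
  fixes f w b p :: real
  assumes "0 \<le> f" "0 < w" "0 < b" "1 < p"
  shows "f \<le> b * w powr (- 1 / (p - 1)) + b powr (1 - p) * (f powr p * w)"
proof (cases "f \<le> b * w powr (- 1 / (p - 1))")
  case True
  then show ?thesis using assms by (simp add: add_increasing2)
next
  case False
  then have lt: "b * w powr (- 1 / (p - 1)) < f" by simp
  have f: "0 < f"
    by (rule le_less_trans[OF _ lt]) (use assms in simp)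
  \<comment> \<open>The factor multiplying \<open>f\<close> equals 1 at the threshold and increases
    with \<open>f\<close>.\<close>
  have "1 = b powr (1 - p) * (b * w powr (- 1 / (p - 1))) powr (p - 1) * w"
  proof -
    have "(b * w powr (- 1 / (p - 1))) powr (p - 1) = b powr (p - 1) * w powr - 1"
      using assms by (simp add: powr_mult powr_powr)
    moreover have "b powr (1 - p) * b powr (p - 1) = 1"
      using assms by (simp flip: powr_add)
    ultimately show ?thesis
      using assms by (simp add: powr_minus mult.assoc[symmetric])
  qed
  also have "\<dots> \<le> b powr (1 - p) * f powr (p - 1) * w"
    using lt assms f by (intro mult_right_mono mult_left_mono powr_mono2) auto
  finally have "f * 1 \<le> f * (b powr (1 - p) * f powr (p - 1) * w)"
    using f by (intro mult_left_mono) auto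
  also have "\<dots> = b powr (1 - p) * (f powr p * w)"
    using f powr_mult_base[of f "p - 1"] by (simp add: mult_ac)
  finally have "f \<le> b powr (1 - p) * (f powr p * w)" by simp
  then show ?thesis using assms by (simp add: add_increasing)
qed

lemma powr_add_le:
  fixes a b p :: real
  assumes "0 \<le> a" "0 \<le> b" "0 \<le> p"
  shows "(a + b) powr p \<le> 2 powr p * (a powr p + b powr p)"
proof -
  have "(a + b) powr p \<le> (2 * max a b) powr p"
    using assms by (intro powr_mono2) auto
  also have "\<dots> = 2 powr p * max a b powr p"
    using assms by (simp add: powr_mult)
  also have "max a b powr p \<le> a powr p + b powr p"
    by (cases "a \<le> b") (auto simp: max_def)
  finally show ?thesis by simp
qed

subsection \<open>Potentials and capacities\<close>

text \<open>The identity \<open>v\<^sup>p w = v\<close> turns the energy of a multiple of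
  \<open>v\<close> into a multiple of its mass. Where \<open>w\<close> vanishes, both sides are
  0.\<close>

lemma dual_weight_powr_mult:
  assumes "0 \<le> w x" "1 < p"
  shows "dual_weight p w x powr p * w x = dual_weight p w x"
proof (cases "w x = 0")
  case False
  have e: "- p / (p - 1) + 1 = - 1 / (p - 1)"
    using assms by (simp add: field_simps)
  have "dual_weight p w x powr p * w x = w x powr (- p / (p - 1)) * w x powr 1"
    using assms by (simp add: dual_weight_def powr_powr)
  also have "\<dots> = w x powr (- 1 / (p - 1))"
    by (simp only: e flip: powr_add)
  finally show ?thesis by (simp add: dual_weight_def)
qed (simp add: dual_weight_def)

lemma riesz_kernel_measurable:
  fixes x :: "real^'n"
  shows "(\<lambda>y. riesz_kernel \<alpha> r (x - y)) \<in> borel_measurable lebesgue"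
proof -
  have [measurable]: "(infnorm :: real^'n \<Rightarrow> real) \<in> borel_measurable borel"
    by (intro borel_measurable_continuous_onI continuous_on_infnorm continuous_intros)
  have "(\<lambda>y. riesz_kernel \<alpha> r (x - y)) \<in> borel_measurable borel"
    unfolding riesz_kernel_def by measurable
  then show ?thesis by (intro measurable_completion) simp
qed

text \<open>The kernel is cut at distance \<open>r\<close>. Beyond it the negative exponent bounds
  the kernel by its value at \<open>r\<close>, and only points of the neighbourhood are
  reached.\<close>

lemma riesz_potential_le_add:
  fixes x :: "real^'n"
  assumes r: "0 < r" and \<alpha>: "\<alpha> < real CARD('n)" and [measurable]: "f \<in> borel_measurable lebesgue"
    and x: "x \<in> grid_cube r k"
  shows "riesz_potential \<alpha> s f x \<le> riesz_potential \<alpha> r f x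
    + ennreal (r powr (\<alpha> - real CARD('n))) * (\<integral>\<^sup>+y\<in>grid_nbhd r s k. ennreal (f y) \<partial>lebesgue)"
proof -
  have [measurable]: "grid_nbhd r s k \<in> sets lebesgue" by (simp add: grid_nbhd_def)
  note [measurable] = riesz_kernel_measurable
  have "riesz_kernel \<alpha> s (x - y) \<le> riesz_kernel \<alpha> r (x - y)
      + r powr (\<alpha> - real CARD('n)) * indicator (grid_nbhd r s k) y" for y
  proof (cases "infnorm (x - y) < s \<and> r \<le> infnorm (x - y)")
    case True
    then have "y \<in> grid_nbhd r s k" using grid_nbhdI[OF r x] by blast
    moreover have "infnorm (x - y) powr (\<alpha> - real CARD('n)) \<le> r powr (\<alpha> - real CARD('n))"
      using r \<alpha> True by (intro powr_mono2') auto
    ultimately show ?thesis using True by (simp add: riesz_kernel_def)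
  next
    case False
    then show ?thesis by (auto simp: riesz_kernel_def)
  qed
  note le = this
  have "ennreal (riesz_kernel \<alpha> s (x - y)) \<le> ennreal (riesz_kernel \<alpha> r (x - y))
      + ennreal (r powr (\<alpha> - real CARD('n))) * indicator (grid_nbhd r s k) y" for y
  proof -
    have "0 \<le> riesz_kernel \<alpha> r (x - y)" by (simp add: riesz_kernel_def)
    then show ?thesis
      using ennreal_leI[OF le[of y]] by (cases "y \<in> grid_nbhd r s k") auto
  qed
  then have "riesz_potential \<alpha> s f x \<le> (\<integral>\<^sup>+y. (ennreal (riesz_kernel \<alpha> r (x - y))
      + ennreal (r powr (\<alpha> - real CARD('n))) * indicator (grid_nbhd r s k) y) * ennreal (f y) \<partial>lebesgue)"
    unfolding riesz_potential_def by (intro nn_integral_mono mult_right_mono) auto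
  also have "\<dots> = (\<integral>\<^sup>+y. ennreal (riesz_kernel \<alpha> r (x - y)) * ennreal (f y)
      + ennreal (r powr (\<alpha> - real CARD('n))) * (ennreal (f y) * indicator (grid_nbhd r s k) y) \<partial>lebesgue)"
    by (intro nn_integral_cong) (simp add: distrib_left distrib_right mult_ac)
  also have "\<dots> = riesz_potential \<alpha> r f x
    + ennreal (r powr (\<alpha> - real CARD('n))) * (\<integral>\<^sup>+y\<in>grid_nbhd r s k. ennreal (f y) \<partial>lebesgue)"
    unfolding riesz_potential_def by (subst nn_integral_add) (auto simp: nn_integral_cmult)
  finally show ?thesis .
qed

text \<open>Two points of one tile are less than \<open>r\<close> apart, where the kernel is at
  least its value at distance \<open>r\<close>.\<close>

lemma riesz_potential_grid_cube_ge:
  fixes x :: "real^'n"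
  assumes r: "0 < r" and \<alpha>: "\<alpha> < real CARD('n)" and x: "x \<in> grid_cube r k"
    and [measurable]: "h \<in> borel_measurable lebesgue"
  shows "ennreal (r powr (\<alpha> - real CARD('n))) * (\<integral>\<^sup>+y\<in>grid_cube r k. ennreal (h y) \<partial>lebesgue)
    \<le> riesz_potential \<alpha> r h x"
proof -
  note [measurable] = grid_cube_sets[OF r]
  have "ennreal (r powr (\<alpha> - real CARD('n))) * (\<integral>\<^sup>+y\<in>grid_cube r k. ennreal (h y) \<partial>lebesgue)
      = (\<integral>\<^sup>+y. ennreal (r powr (\<alpha> - real CARD('n))) * (ennreal (h y) * indicator (grid_cube r k) y) \<partial>lebesgue)"
    by (simp add: nn_integral_cmult)
  also have "\<dots> \<le> riesz_potential \<alpha> r h x"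
    unfolding riesz_potential_def
  proof (rule nn_integral_mono_AE)
    \<comment> \<open>At \<open>y = x\<close> the kernel has the default value 0, so the pointwise
      bound can fail there.\<close>
    have "AE y in lebesgue. y \<noteq> x"
      using AE_not_in[of "{x}" lebesgue] by (simp flip: negligible_iff_null_sets)
    then show "AE y in lebesgue. ennreal (r powr (\<alpha> - real CARD('n))) * (ennreal (h y) * indicator (grid_cube r k) y)
        \<le> ennreal (riesz_kernel \<alpha> r (x - y)) * ennreal (h y)"
    proof eventually_elim
      case (elim y)
      show ?case
      proof (cases "y \<in> grid_cube r k")
        case True
        then have d: "infnorm (x - y) < r" by (intro grid_cube_diameter[OF r x])
        moreover have "0 < infnorm (x - y)" using elim by (simp add: infnorm_pos_lt)
        ultimately have "r powr (\<alpha> - real CARD('n)) \<le> riesz_kernel \<alpha> r (x - y)"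
          unfolding riesz_kernel_def using \<alpha> by (auto intro!: powr_mono2')
        then show ?thesis using True by (auto intro!: mult_right_mono ennreal_leI)
      qed simp
    qed
  qed
  finally show ?thesis .
qed

text \<open>With \<open>X k\<close> the energy of \<open>f\<close> near the grid cube \<open>k\<close> and \<open>W k\<close> the dual mass of that cube,
  the amplitude \<open>b k = (X k / W k) powr (1 / p)\<close> makes the energy of \<open>b k\<close> times the dual weight on the
  cube equal to \<open>X k\<close>.\<close>

lemma riesz_capacity_le_of_doubling:
  fixes w :: "real^'n \<Rightarrow> real"
  assumes \<alpha>: "\<alpha> < real CARD('n)" and p: "1 < p" and r: "0 < r" and s: "0 < s"
    and w: "weight w" and w': "weight (dual_weight p w)" and D: "0 \<le> D"
    and doubling: "\<And>k. (LINT x:grid_nbhd r s k|lebesgue. dual_weight p w x)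
      \<le> D * (LINT x:grid_cube r k|lebesgue. dual_weight p w x)"
  shows "riesz_capacity \<alpha> p r w E
    \<le> ennreal (2 powr p * (1 + (1 + D) powr p * (2 * s / r + 2) ^ CARD('n))) * riesz_capacity \<alpha> p s w E"
proof -
  define v where "v = dual_weight p w"
  define M where "M = (2 * s / r + 2) ^ CARD('n)"
  define K where "K = 2 powr p * (1 + (1 + D) powr p * M)"
  have M: "0 \<le> M" unfolding M_def using r s by simp
  have K: "0 < K" unfolding K_def using M by (intro mult_pos_pos add_pos_nonneg) auto
  note weight_measurable[OF w, measurable] grid_cube_sets[OF r, measurable]
  have [measurable]: "v \<in> borel_measurable lebesgue"
    using weight_measurable[OF w'] by (simp add: v_def)
  have [measurable]: "grid_nbhd r s k \<in> sets lebesgue" for k :: "'n \<Rightarrow> int"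
    by (simp add: grid_nbhd_def)
  have w0: "0 \<le> w x" and v0: "0 \<le> v x" for x
    using weight_nonneg[OF w] weight_nonneg[OF w'] by (auto simp: v_def)
  have nbhd_int: "set_integrable lebesgue (grid_nbhd r s k) v" for k
    unfolding v_def grid_nbhd_def by (rule weight_integrable_cube[OF w'])
  have cube_int: "set_integrable lebesgue (grid_cube r k) v" for k
    unfolding v_def by (rule weight_integrable_grid_cube[OF w' r])
  define W where "W k = (LINT x:grid_cube r k|lebesgue. v x)" for k
  have W: "0 < W k" for k
  proof -
    have "ennreal (r ^ CARD('n)) \<le> emeasure lebesgue (grid_cube r k)"
      using emeasure_mono[OF cube_subset_grid_cube[OF r, of k], of lebesgue] r
      by (simp add: emeasure_cube del: emeasure_completion)
    then have "emeasure lebesgue (grid_cube r k) \<noteq> 0"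
      using r by (auto simp del: emeasure_completion)
    then show ?thesis
      unfolding W_def using weight_pos_AE[OF w']
      by (intro set_LINT_pos[OF cube_int v0]) (auto simp: v_def)
  qed
  \<comment> \<open>Each \<open>f\<close> admissible for \<open>s\<close> is turned into a
    \<open>g\<close> admissible for \<open>r\<close>, with energy at most \<open>K\<close> times
    that of \<open>f\<close>.\<close>
  have bound: "riesz_capacity \<alpha> p r w E \<le> ennreal K * (\<integral>\<^sup>+ x. ennreal (f x powr p * w x) \<partial>lebesgue)"
    if fm [measurable]: "f \<in> borel_measurable lebesgue" and f0: "\<And>x. 0 \<le> f x"
      and fin: "(\<integral>\<^sup>+ x. ennreal (f x powr p * w x) \<partial>lebesgue) < \<infinity>"
      and adm: "\<And>x. x \<in> E \<Longrightarrow> 1 \<le> riesz_potential \<alpha> s f x" for f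
  proof -
    define J where "J = (\<integral>\<^sup>+ x. ennreal (f x powr p * w x) \<partial>lebesgue)"
    define X where "X k = enn2real (\<integral>\<^sup>+x\<in>grid_nbhd r s k. ennreal (f x powr p * w x) \<partial>lebesgue)" for k
    define b where "b k = (X k / W k) powr (1 / p)" for k
    \<comment> \<open>The factor \<open>1 + D\<close> is that of \<open>far\<close>:
      \<open>D\<close> accounts for the dual mass of the neighbourhood, 1 for the energy
      term.\<close>
    define h where "h k x = (1 + D) * b k * v x" for k x
    define g where "g x = f x + h (grid_index r x) x" for x
    have X: "(\<integral>\<^sup>+x\<in>grid_nbhd r s k. ennreal (f x powr p * w x) \<partial>lebesgue) = ennreal (X k)" for k
    proof -
      have "(\<integral>\<^sup>+x\<in>grid_nbhd r s k. ennreal (f x powr p * w x) \<partial>lebesgue) \<le> J"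
        unfolding J_def by (intro nn_integral_mono) (auto simp: indicator_def)
      then show ?thesis
        using fin unfolding X_def J_def by (intro ennreal_enn2real[symmetric]) (auto simp: less_top dest: le_less_trans)
    qed
    have X0: "0 \<le> X k" for k by (simp add: X_def)
    have b0: "0 \<le> b k" for k by (simp add: b_def)
    have h0: "0 \<le> h k x" for k x using D b0 v0 by (simp add: h_def)
    have bp: "b k powr p * W k = X k" for k
      using p X0[of k] W[of k] by (simp add: b_def powr_powr)
    have hm [measurable]: "h k \<in> borel_measurable lebesgue" for k
      unfolding h_def[abs_def] by measurable
    have hgm [measurable]: "(\<lambda>x. h (grid_index r x) x) \<in> borel_measurable lebesgue"
      by (rule measurable_compose_countable[OF hm grid_index_measurable[OF r]])
    have gm: "g \<in> borel_measurable lebesgue"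
      unfolding g_def[abs_def] by measurable
    have int_h: "(\<integral>\<^sup>+x\<in>grid_cube r k. ennreal (h k x) \<partial>lebesgue) = ennreal ((1 + D) * b k * W k)" for k
    proof -
      have "(\<integral>\<^sup>+x\<in>grid_cube r k. ennreal (h k x) \<partial>lebesgue)
          = ennreal ((1 + D) * b k) * (\<integral>\<^sup>+x\<in>grid_cube r k. ennreal (v x) \<partial>lebesgue)"
        unfolding h_def using D b0 v0 by (simp add: ennreal_mult nn_integral_cmult mult.assoc)
      then show ?thesis
        using D b0[of k] W[of k] set_nn_integral_eq_set_LINT[OF cube_int v0, of k]
        by (simp add: W_def ennreal_mult')
    qed
    have far: "(\<integral>\<^sup>+x\<in>grid_nbhd r s k. ennreal (f x) \<partial>lebesgue) \<le> ennreal ((1 + D) * b k * W k)" for k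
    proof (cases "X k = 0")
      case True
      then have "AE x in lebesgue. ennreal (f x powr p * w x) * indicator (grid_nbhd r s k) x = 0"
        using X[of k] by (subst nn_integral_0_iff_AE[symmetric]) auto
      then have "AE x in lebesgue. ennreal (f x) * indicator (grid_nbhd r s k) x = 0"
        using weight_pos_AE[OF w]
      proof eventually_elim
        case (elim x)
        then show ?case
          using f0[of x] by (auto simp: indicator_def ennreal_eq_0_iff mult_le_0_iff split: if_splits)
      qed
      then have "(\<integral>\<^sup>+x\<in>grid_nbhd r s k. ennreal (f x) \<partial>lebesgue) = 0"
        by (subst nn_integral_0_iff_AE) auto
      then show ?thesis by simp
    next
      case False
      then have b: "0 < b k"
        using X0[of k] W[of k] by (simp add: b_def)
      have "(\<integral>\<^sup>+x\<in>grid_nbhd r s k. ennreal (f x) \<partial>lebesgue)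
          \<le> (\<integral>\<^sup>+x. ennreal (b k) * (ennreal (v x) * indicator (grid_nbhd r s k) x)
            + ennreal (b k powr (1 - p)) * (ennreal (f x powr p * w x) * indicator (grid_nbhd r s k) x) \<partial>lebesgue)"
      proof (rule nn_integral_mono_AE)
        show "AE x in lebesgue. ennreal (f x) * indicator (grid_nbhd r s k) x
          \<le> ennreal (b k) * (ennreal (v x) * indicator (grid_nbhd r s k) x)
            + ennreal (b k powr (1 - p)) * (ennreal (f x powr p * w x) * indicator (grid_nbhd r s k) x)"
          using weight_pos_AE[OF w]
        proof eventually_elim
          case (elim x)
          have "ennreal (f x) \<le> ennreal (b k * v x + b k powr (1 - p) * (f x powr p * w x))"
            using le_dual_weight_add[OF f0[of x] elim b p]
            by (intro ennreal_leI) (simp add: v_def dual_weight_def)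
          then show ?case
            using b v0[of x] elim by (auto simp: indicator_def ennreal_mult)
        qed
      qed
      also have "\<dots> = ennreal (b k) * (\<integral>\<^sup>+x\<in>grid_nbhd r s k. ennreal (v x) \<partial>lebesgue)
          + ennreal (b k powr (1 - p)) * ennreal (X k)"
        by (subst nn_integral_add) (auto simp: nn_integral_cmult X)
      also have "\<dots> \<le> ennreal (b k) * ennreal (D * W k) + ennreal (b k powr (1 - p)) * ennreal (X k)"
        using set_nn_integral_eq_set_LINT[OF nbhd_int v0, of k] doubling[of k]
        by (auto intro!: add_right_mono mult_left_mono ennreal_leI simp: W_def v_def)
      also have "\<dots> = ennreal (b k * (D * W k) + b k powr (1 - p) * X k)"
        using b D W[of k] X0[of k] by (simp add: ennreal_mult)
      \<comment> \<open>By \<open>bp\<close> the chosen amplitude gives the energy term the same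
        form as the mass term.\<close>
      also have "b k powr (1 - p) * X k = b k * W k"
        unfolding bp[symmetric] using b by (simp flip: mult.assoc powr_add)
      also have "b k * (D * W k) + b k * W k = (1 + D) * b k * W k"
        by (simp add: algebra_simps)
      finally show ?thesis .
    qed
    \<comment> \<open>What the potential of \<open>f\<close> loses when the radius shrinks to
      \<open>r\<close> is made up by the correction on the tile of \<open>x\<close> alone.\<close>
    have "1 \<le> riesz_potential \<alpha> r g x" if "x \<in> E" for x
    proof -
      define k where "k = grid_index r x"
      have x: "x \<in> grid_cube r k" by (simp add: grid_cube_def k_def)
      let ?c = "ennreal (r powr (\<alpha> - real CARD('n)))"
      have "1 \<le> riesz_potential \<alpha> r f x + ?c * (\<integral>\<^sup>+y\<in>grid_nbhd r s k. ennreal (f y) \<partial>lebesgue)"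
        using adm[OF that] riesz_potential_le_add[OF r \<alpha> fm x]
        by (rule order_trans)
      also have "\<dots> \<le> riesz_potential \<alpha> r f x
          + ?c * (\<integral>\<^sup>+y\<in>grid_cube r k. ennreal (h (grid_index r y) y) \<partial>lebesgue)"
      proof -
        have "(\<integral>\<^sup>+y\<in>grid_cube r k. ennreal (h (grid_index r y) y) \<partial>lebesgue)
            = (\<integral>\<^sup>+y\<in>grid_cube r k. ennreal (h k y) \<partial>lebesgue)"
          by (intro nn_integral_cong) (auto simp: grid_cube_def indicator_def)
        then show ?thesis
          using far[of k] by (auto intro!: add_left_mono mult_left_mono simp: int_h)
      qed
      also have "\<dots> \<le> riesz_potential \<alpha> r f x + riesz_potential \<alpha> r (\<lambda>y. h (grid_index r y) y) x"
        by (intro add_left_mono riesz_potential_grid_cube_ge[OF r \<alpha> x]) simp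
      also have "\<dots> = riesz_potential \<alpha> r g x"
      proof -
        have [measurable]: "(\<lambda>y. riesz_kernel \<alpha> r (x - y)) \<in> borel_measurable lebesgue"
          by (rule riesz_kernel_measurable)
        show ?thesis
          unfolding riesz_potential_def g_def using f0 h0
          by (subst nn_integral_add[symmetric]) (auto simp: distrib_left)
      qed
      finally show ?thesis .
    qed
    moreover have energy: "(\<integral>\<^sup>+ x. ennreal (g x powr p * w x) \<partial>lebesgue) \<le> ennreal K * J"
    proof -
      \<comment> \<open>The power of the sum costs \<open>2 powr p\<close>, and
        \<open>v\<^sup>p w = v\<close> removes the power of \<open>v\<close> from the
        correction.\<close>
      have pw: "g x powr p * w x \<le> 2 powr p * (f x powr p * w x)
          + 2 powr p * (1 + D) powr p * (b (grid_index r x) powr p * v x)" for x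
      proof -
        have "g x powr p * w x \<le> 2 powr p * (f x powr p + h (grid_index r x) x powr p) * w x"
          unfolding g_def using f0 h0 p w0 by (intro mult_right_mono powr_add_le) auto
        also have "h (grid_index r x) x powr p = (1 + D) powr p * b (grid_index r x) powr p * v x powr p"
          using D b0 v0 by (simp add: h_def powr_mult)
        also have "2 powr p * (f x powr p + (1 + D) powr p * b (grid_index r x) powr p * v x powr p) * w x
            = 2 powr p * (f x powr p * w x)
              + 2 powr p * (1 + D) powr p * (b (grid_index r x) powr p * (v x powr p * w x))"
          by (simp add: algebra_simps)
        also have "v x powr p * w x = v x"
          unfolding v_def using w0 p by (rule dual_weight_powr_mult)
        finally show ?thesis .
      qed
      \<comment> \<open>On the tile \<open>k\<close> the integral is
        \<open>b k powr p * W k = X k\<close>, the energy of \<open>f\<close> on the neighbourhood;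
        bounded overlap then sums these to at most \<open>M * J\<close>.\<close>
      have sum: "(\<integral>\<^sup>+x. ennreal (b (grid_index r x) powr p * v x) \<partial>lebesgue) \<le> ennreal M * J"
      proof -
        have "(\<integral>\<^sup>+x. ennreal (b (grid_index r x) powr p * v x) \<partial>lebesgue)
            = (\<integral>\<^sup>+k. (\<integral>\<^sup>+x\<in>grid_cube r k. ennreal (b k powr p * v x) \<partial>lebesgue) \<partial>count_space UNIV)"
          by (rule nn_integral_grid[OF r, of "\<lambda>k x. ennreal (b k powr p * v x)"]) simp
        also have "\<dots> = (\<integral>\<^sup>+k. (\<integral>\<^sup>+x\<in>grid_nbhd r s k. ennreal (f x powr p * w x) \<partial>lebesgue) \<partial>count_space UNIV)"
        proof (rule nn_integral_cong)
          fix k :: "'n \<Rightarrow> int"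
          have "(\<integral>\<^sup>+x\<in>grid_cube r k. ennreal (b k powr p * v x) \<partial>lebesgue)
              = ennreal (b k powr p) * (\<integral>\<^sup>+x\<in>grid_cube r k. ennreal (v x) \<partial>lebesgue)"
            using v0 by (simp add: ennreal_mult nn_integral_cmult mult.assoc)
          also have "\<dots> = ennreal (b k powr p * W k)"
            using W[of k] set_nn_integral_eq_set_LINT[OF cube_int v0, of k]
            by (simp add: W_def ennreal_mult')
          finally show "(\<integral>\<^sup>+x\<in>grid_cube r k. ennreal (b k powr p * v x) \<partial>lebesgue)
              = (\<integral>\<^sup>+x\<in>grid_nbhd r s k. ennreal (f x powr p * w x) \<partial>lebesgue)"
            by (simp add: bp X)
        qed
        also have "\<dots> \<le> ennreal M * J"
          unfolding M_def J_def by (rule nn_integral_grid_nbhd_le[OF r s]) simp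
        finally show ?thesis .
      qed
      have bm [measurable]: "(\<lambda>x. b (grid_index r x) powr p * v x) \<in> borel_measurable lebesgue"
        by (rule measurable_compose_countable[OF _ grid_index_measurable[OF r],
              of "\<lambda>k x. b k powr p * v x"]) simp
      have "(\<integral>\<^sup>+ x. ennreal (g x powr p * w x) \<partial>lebesgue)
          \<le> (\<integral>\<^sup>+ x. ennreal (2 powr p) * ennreal (f x powr p * w x)
            + ennreal (2 powr p * (1 + D) powr p) * ennreal (b (grid_index r x) powr p * v x) \<partial>lebesgue)"
      proof (rule nn_integral_mono)
        fix x
        show "ennreal (g x powr p * w x) \<le> ennreal (2 powr p) * ennreal (f x powr p * w x)
            + ennreal (2 powr p * (1 + D) powr p) * ennreal (b (grid_index r x) powr p * v x)"
          using ennreal_leI[OF pw[of x]] w0 v0 by (simp add: ennreal_mult)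
      qed
      also have "\<dots> = ennreal (2 powr p) * J
          + ennreal (2 powr p * (1 + D) powr p) * (\<integral>\<^sup>+x. ennreal (b (grid_index r x) powr p * v x) \<partial>lebesgue)"
        unfolding J_def by (subst nn_integral_add) (auto simp: nn_integral_cmult)
      also have "\<dots> \<le> ennreal (2 powr p) * J + ennreal (2 powr p * (1 + D) powr p) * (ennreal M * J)"
        using sum by (intro add_left_mono mult_left_mono) auto
      also have "\<dots> = (ennreal (2 powr p) + ennreal (2 powr p * (1 + D) powr p) * ennreal M) * J"
        by (simp add: distrib_right mult.assoc)
      also have "ennreal (2 powr p) + ennreal (2 powr p * (1 + D) powr p) * ennreal M = ennreal K"
        unfolding K_def using M by (simp add: ennreal_mult[symmetric] ennreal_plus[symmetric] algebra_simps del: ennreal_plus)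
      finally show ?thesis .
    qed
    moreover have "(\<integral>\<^sup>+ x. ennreal (g x powr p * w x) \<partial>lebesgue) < \<infinity>"
      using energy fin by (auto simp: J_def ennreal_mult_less_top intro: le_less_trans)
    moreover have "0 \<le> g x" for x using f0 h0 by (simp add: g_def)
    ultimately show ?thesis
      unfolding J_def riesz_capacity_def using gm by (intro Inf_lower2[OF _ energy[unfolded J_def]]) auto
  qed
  \<comment> \<open>With the constant moved to the left, the bound for each \<open>f\<close> passes
    to the infimum, also when no \<open>f\<close> is admissible.\<close>
  have "riesz_capacity \<alpha> p r w E / ennreal K \<le> riesz_capacity \<alpha> p s w E"
    unfolding riesz_capacity_def[of \<alpha> p s]
  proof (rule Inf_greatest)
    fix t assume "t \<in> {(\<integral>\<^sup>+ x. ennreal (f x powr p * w x) \<partial>lebesgue) | f.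
            f \<in> borel_measurable lebesgue \<and> (\<forall>x. 0 \<le> f x) \<and>
            (\<integral>\<^sup>+ x. ennreal (f x powr p * w x) \<partial>lebesgue) < \<infinity> \<and>
            (\<forall>x\<in>E. 1 \<le> riesz_potential \<alpha> s f x)}"
    then have "riesz_capacity \<alpha> p r w E \<le> ennreal K * t"
      using bound by auto
    then show "riesz_capacity \<alpha> p r w E / ennreal K \<le> t"
      using K by (intro divide_le_posI_ennreal) auto
  qed
  then have "ennreal K * (riesz_capacity \<alpha> p r w E / ennreal K) \<le> ennreal K * riesz_capacity \<alpha> p s w E"
    by (rule mult_left_mono) simp
  moreover have "ennreal K * (riesz_capacity \<alpha> p r w E / ennreal K) = riesz_capacity \<alpha> p r w E"
    using K by (subst ennreal_times_divide, subst mult.commute, intro mult_divide_eq_ennreal) auto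
  ultimately show ?thesis by (simp add: K_def M_def)
qed

section \<open>Explicit constants and the comparison of capacities\<close>

text \<open>A larger radius gives a larger kernel and hence more admissible functions.\<close>

lemma riesz_capacity_antimono:
  fixes w :: "real^'n \<Rightarrow> real"
  assumes "r \<le> s"
  shows "riesz_capacity \<alpha> p s w E \<le> riesz_capacity \<alpha> p r w E"
proof -
  have "riesz_potential \<alpha> r f x \<le> riesz_potential \<alpha> s f x" for f and x :: "real^'n"
    unfolding riesz_potential_def using assms
    by (intro nn_integral_mono mult_right_mono ennreal_leI) (auto simp: riesz_kernel_def)
  then have "1 \<le> riesz_potential \<alpha> r f x \<Longrightarrow> 1 \<le> riesz_potential \<alpha> s f x" for f and x :: "real^'n"
    by (rule order_trans[rotated])
  then show ?thesis
    unfolding riesz_capacity_def by (intro Inf_superset_mono Collect_mono ex_mono) auto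
qed

text \<open>The factor in \<open>Ainf_cube_doubling\<close> for the volume ratio
  \<open>N\<close>.\<close>

definition doubling_const :: "real \<Rightarrow> real \<Rightarrow> real" where
  "doubling_const N A = N * (exp 1 * A powr N)"

text \<open>The constant of \<open>riesz_capacity_le_of_doubling\<close> for
  \<open>q = s / r\<close>, where \<open>(1 + 2 * q) ^ CARD('n)\<close> is the volume ratio of
  neighbourhood and tile. The argument of type \<open>'n itself\<close> supplies the
  dimension.\<close>

definition capacity_const :: "'n itself \<Rightarrow> real \<Rightarrow> real \<Rightarrow> real \<Rightarrow> real" where
  "capacity_const (T :: 'n itself) p q A = 2 powr p * (1 + (1 + doubling_const ((1 + 2 * q) ^ CARD('n)) A) powr p * (2 * q + 2) ^ CARD('n))"

lemma capacity_const_ge_1: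
  assumes "0 \<le> p" "0 \<le> q"
  shows "1 \<le> capacity_const TYPE('n) p q A"
proof -
  have "1 * 1 \<le> 2 powr p * (1 + (1 + doubling_const ((1 + 2 * q) ^ CARD('n)) A) powr p * (2 * q + 2) ^ CARD('n))"
    using assms by (intro mult_mono ge_one_powr_ge_zero) auto
  then show ?thesis by (simp add: capacity_const_def)
qed

text \<open>All neighbourhoods are cubes of side \<open>r + 2 * s\<close>, so the bound is assumed
  at this side only. Doubling is applied to the open cube inside the half-open tile.\<close>

lemma riesz_capacity_le_of_Ainf_cube:
  fixes w :: "real^'n \<Rightarrow> real"
  assumes \<alpha>: "\<alpha> < real CARD('n)" and p: "1 < p" and r: "0 < r" and s: "0 < s"
    and w: "weight w" and w': "weight (dual_weight p w)"
    and A: "\<And>a. avg (cube a (r + 2 * s)) (dual_weight p w)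
      * exp_avg_log_inverse (cube a (r + 2 * s)) (dual_weight p w) \<le> ennreal A"
  shows "riesz_capacity \<alpha> p r w E \<le> ennreal (capacity_const TYPE('n) p (s / r) A) * riesz_capacity \<alpha> p s w E"
proof -
  define D where "D = doubling_const ((1 + 2 * (s / r)) ^ CARD('n)) A"
  have D: "0 \<le> D" unfolding D_def doubling_const_def using r s by simp
  have ratio: "(r + 2 * s) / r = 1 + 2 * (s / r)" using r by (simp add: field_simps)
  have "(LINT x:grid_nbhd r s k|lebesgue. dual_weight p w x)
      \<le> D * (LINT x:grid_cube r k|lebesgue. dual_weight p w x)" for k
  proof -
    let ?P = "cube (\<chi> i. r * of_int (k i)) r :: (real^'n) set"
    have "(LINT x:grid_nbhd r s k|lebesgue. dual_weight p w x) \<le> D * (LINT x:?P|lebesgue. dual_weight p w x)"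
      using weight_cube_doubling[OF w' A r, of _ "\<chi> i. r * of_int (k i) - s"] cube_subset_grid_nbhd[OF r s, of k] r s
      unfolding grid_nbhd_def D_def doubling_const_def ratio[symmetric] by simp
    also have "(LINT x:?P|lebesgue. dual_weight p w x) \<le> (LINT x:grid_cube r k|lebesgue. dual_weight p w x)"
      using weight_integrable_cube[OF w'] weight_integrable_grid_cube[OF w' r, of k]
        cube_subset_grid_cube[OF r, of k] weight_nonneg[OF w']
      unfolding set_lebesgue_integral_def set_integrable_def
      by (intro integral_mono) (auto simp: indicator_def)
    finally show ?thesis using D by (simp add: mult_left_mono)
  qed
  from riesz_capacity_le_of_doubling[OF \<alpha> p r s w w' D this]
  show ?thesis by (simp add: capacity_const_def D_def)
qed

lemma comparableI:
  fixes A B :: "(real^'n) set \<Rightarrow> ennreal"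
  assumes "1 \<le> K" "\<And>E. B E \<le> A E" "\<And>E. A E \<le> ennreal K * B E"
  shows "comparable K A B"
proof -
  have "ennreal (inverse K) * B E \<le> A E" for E
  proof -
    have "ennreal (inverse K) * B E \<le> 1 * B E"
      using assms(1) by (intro mult_right_mono) (auto simp: inverse_le_1_iff)
    then show ?thesis using assms(2)[of E] by simp
  qed
  then show ?thesis
    using assms by (simp add: comparable_def)
qed

theorem proposition3p5p1:
  shows "(\<exists>C :: real \<Rightarrow> real \<Rightarrow> ennreal \<Rightarrow> real. (\<forall>\<alpha> p t. 0 < C \<alpha> p t) \<and>
      (\<forall>\<alpha> p \<rho>. \<forall>w :: real^'n \<Rightarrow> real.
         0 < \<alpha> \<and> \<alpha> < real CARD('n) \<and> 1 < p \<and> 0 < \<rho> \<and> weight w \<and> dual_weight p w \<in> Ainf_loc \<longrightarrow>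
         (\<forall>E. riesz_capacity \<alpha> p \<rho> w E
              \<le> ennreal (C \<alpha> p (Ainf_const (20 * \<rho>) (dual_weight p w)))
                 * riesz_capacity \<alpha> p (2 * \<rho>) w E)))
    \<and> (\<exists>c0 > 0. \<exists>K :: real \<Rightarrow> real \<Rightarrow> real \<Rightarrow> ennreal \<Rightarrow> real.
      (\<forall>\<alpha> p \<rho>1 \<rho>2. \<forall>w :: real^'n \<Rightarrow> real.
         0 < \<alpha> \<and> \<alpha> < real CARD('n) \<and> 1 < p \<and> 0 < \<rho>1 \<and> \<rho>1 < \<rho>2 \<and>
         weight w \<and> dual_weight p w \<in> Ainf_loc \<longrightarrow>
         (\<exists>k. comparable k (riesz_capacity \<alpha> p \<rho>1 w) (riesz_capacity \<alpha> p \<rho>2 w)) \<and>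
         (let c = c0 * (\<rho>2 / \<rho>1) in
            Ap_const p (c * \<rho>1) w < \<infinity> \<longrightarrow>
            comparable (K \<alpha> p c (Ap_const p (c * \<rho>1) w))
              (riesz_capacity \<alpha> p \<rho>1 w) (riesz_capacity \<alpha> p \<rho>2 w))))"
  (is "(\<exists>C. ?pos C \<and> ?one C) \<and> (\<exists>c0>0. \<exists>K. ?two c0 K)")
proof
  \<comment> \<open>The ratio of the radii is 2. Positivity is claimed for every real
    \<open>p\<close>, and \<open>max p 0\<close> brings it into the range of
    \<open>capacity_const_ge_1\<close>.\<close>
  define C where "C \<alpha> p t = capacity_const TYPE('n) (max p 0) 2 (enn2real t)" for \<alpha> p :: real and t
  have "0 < C \<alpha> p t" for \<alpha> p t
    using capacity_const_ge_1[of "max p 0" 2, where ?'n = 'n] unfolding C_def by (smt (verit))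
  moreover have "?one C"
  proof (intro allI impI; elim conjE)
    fix \<alpha> p \<rho> :: real and w :: "real^'n \<Rightarrow> real" and E
    assume h: "0 < \<alpha>" "\<alpha> < real CARD('n)" "1 < p" "0 < \<rho>" "weight w" "dual_weight p w \<in> Ainf_loc"
    have "weight (dual_weight p w)" using h(6) by (simp add: Ainf_loc_def)
    then show "riesz_capacity \<alpha> p \<rho> w E \<le> ennreal (C \<alpha> p (Ainf_const (20 * \<rho>) (dual_weight p w)))
        * riesz_capacity \<alpha> p (2 * \<rho>) w E"
      \<comment> \<open>The neighbourhoods have side \<open>5 * \<rho>\<close>, which is below the
        scale \<open>20 * \<rho>\<close>.\<close>
      using riesz_capacity_le_of_Ainf_cube[OF h(2,3,4) _ h(5), of "2 * \<rho>"]
        Ainf_constD[OF Ainf_loc_const_finite[OF h(6)], of "\<rho> + 2 * (2 * \<rho>)" "20 * \<rho>"] h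
      by (simp add: C_def)
  qed
  ultimately show "\<exists>C. ?pos C \<and> ?one C" by blast
next
  \<comment> \<open>With \<open>c = 3 * (\<rho>2 / \<rho>1)\<close>, the quotient
    \<open>c / 3\<close> is the ratio of the radii; the power of \<open>t\<close> is the bound of
    \<open>Ap_const_dual_Ainf\<close>.\<close>
  define K where "K \<alpha> p c t = capacity_const TYPE('n) p (c / 3) (enn2real t powr (1 / (p - 1)))"
    for \<alpha> p c :: real and t
  have "?two 3 K"
  proof (intro allI impI; elim conjE)
    fix \<alpha> p \<rho>1 \<rho>2 :: real and w :: "real^'n \<Rightarrow> real"
    assume h: "0 < \<alpha>" "\<alpha> < real CARD('n)" "1 < p" "0 < \<rho>1" "\<rho>1 < \<rho>2" "weight w" "dual_weight p w \<in> Ainf_loc"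
    have w': "weight (dual_weight p w)" using h(7) by (simp add: Ainf_loc_def)
    have \<rho>2: "0 < \<rho>2" using h by simp
    have comp: "comparable (capacity_const TYPE('n) p (\<rho>2 / \<rho>1) A) (riesz_capacity \<alpha> p \<rho>1 w) (riesz_capacity \<alpha> p \<rho>2 w)"
      if "\<And>a. avg (cube a (\<rho>1 + 2 * \<rho>2)) (dual_weight p w)
        * exp_avg_log_inverse (cube a (\<rho>1 + 2 * \<rho>2)) (dual_weight p w) \<le> ennreal A" for A
      using h \<rho>2 w' that
      by (intro comparableI capacity_const_ge_1 riesz_capacity_antimono riesz_capacity_le_of_Ainf_cube) auto
    show "(\<exists>k. comparable k (riesz_capacity \<alpha> p \<rho>1 w) (riesz_capacity \<alpha> p \<rho>2 w)) \<and>
         (let c = 3 * (\<rho>2 / \<rho>1) in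
            Ap_const p (c * \<rho>1) w < \<infinity> \<longrightarrow>
            comparable (K \<alpha> p c (Ap_const p (c * \<rho>1) w))
              (riesz_capacity \<alpha> p \<rho>1 w) (riesz_capacity \<alpha> p \<rho>2 w))"
      unfolding Let_def
    proof (intro conjI impI)
      \<comment> \<open>Here the constant comes from the \<open>A\<^sub>\<infinity>\<close> constant
        at scale \<open>\<rho>1 + 2 * \<rho>2\<close>, which is finite for every weight of the
        class.\<close>
      show "\<exists>k. comparable k (riesz_capacity \<alpha> p \<rho>1 w) (riesz_capacity \<alpha> p \<rho>2 w)"
        using comp[OF Ainf_constD[OF Ainf_loc_const_finite[OF h(7)] _ order_refl]] h \<rho>2 by auto
    next
      \<comment> \<open>The scale is \<open>3 * \<rho>2\<close>, which exceeds the side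
        \<open>\<rho>1 + 2 * \<rho>2\<close> of the neighbourhoods because
        \<open>\<rho>1 < \<rho>2\<close>; this explains the choice \<open>c0 = 3\<close>.\<close>
      assume "Ap_const p (3 * (\<rho>2 / \<rho>1) * \<rho>1) w < \<infinity>"
      then show "comparable (K \<alpha> p (3 * (\<rho>2 / \<rho>1)) (Ap_const p (3 * (\<rho>2 / \<rho>1) * \<rho>1) w))
          (riesz_capacity \<alpha> p \<rho>1 w) (riesz_capacity \<alpha> p \<rho>2 w)"
        using h comp[OF Ap_const_dual_Ainf[OF h(6) w' h(3), of "3 * \<rho>2"]] by (simp add: K_def)
    qed
  qed
  then show "\<exists>c0>0. \<exists>K. ?two c0 K" by (intro exI[of _ 3] conjI exI[of _ K]) auto
qed

end
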